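(* Let $T$ be a tree of order $n \geq 2$ with diameter $d$ and with $p$ pendant vertices. Let $K$ be a field, let $S=K[V(T)]$ be the polynomial ring over $K$ whose variables are the vertices of $T$, and let $I=I(T)\subset S$ be the edge ideal of $T$. Then $$\operatorname{reg}(S/I) \geq \left\lfloor \frac{n-p+d+5}{6} \right\rfloor .$$
   Context: All graphs are finite and simple. A tree is a connected acyclic graph; its order is its number of vertices. The diameter of a graph is the maximum distance between two of its vertices. A pendant vertex is a vertex of degree one. For a graph $G$ with vertex set $V(G)=\{x_1,\dots,x_n\}$ and edge set $E(G)$, the edge ideal is the squarefree monomial ideal $I(G)=(x_ix_j : \{x_i,x_j\}\in E(G))$ of $K[V(G)]=K[x_1,\dots,x_n]$, which carries the standard grading. For a finitely generated graded module $M$ over a standard graded polynomial ring, with graded Betti numbers $\beta_{i,j}(M)$ (the number of copies of $S(-j)$ in homological degree $i$ of the minimal graded free resolution), the Castelnuovo-Mumford regularity is $\operatorname{reg}(M)=\max\{j-i : \beta_{i,j}(M)\neq 0\}$. *)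

theory Defs
  imports
    Complex_Main
    "HOL-Library.Poly_Mapping"
    "HOL-Library.Cardinality"
    "Jordan_Normal_Form.Matrix"
begin

section \<open>Finite simple graphs\<close>

text \<open>
  The vertex set of a graph is the whole (finite) vertex type; a graph is given by its set of
  edges, each edge being a two-element set of vertices.
\<close>

definition simple_graph :: "'v set set \<Rightarrow> bool" where
  "simple_graph E \<longleftrightarrow> (\<forall>e\<in>E. card e = 2)"

text \<open>Walks are given by their sequence of vertices; the length of a walk is
  one less than the length of that list.\<close>

definition walk_betw :: "'v set set \<Rightarrow> 'v \<Rightarrow> 'v list \<Rightarrow> 'v \<Rightarrow> bool" where
  "walk_betw E u xs v \<longleftrightarrow>
     xs \<noteq> [] \<and> hd xs = u \<and> last xs = v \<and> successively (\<lambda>x y. {x, y} \<in> E) xs"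

definition connected_graph :: "'v set set \<Rightarrow> bool" where
  "connected_graph E \<longleftrightarrow> (\<forall>u v. \<exists>xs. walk_betw E u xs v)"

definition graph_cycle :: "'v set set \<Rightarrow> 'v list \<Rightarrow> bool" where
  "graph_cycle E xs \<longleftrightarrow>
     length xs \<ge> 3 \<and> distinct xs \<and> successively (\<lambda>x y. {x, y} \<in> E) xs \<and> {last xs, hd xs} \<in> E"

definition is_tree :: "'v set set \<Rightarrow> bool" where
  "is_tree E \<longleftrightarrow> simple_graph E \<and> connected_graph E \<and> (\<nexists>xs. graph_cycle E xs)"

definition graph_dist :: "'v set set \<Rightarrow> 'v \<Rightarrow> 'v \<Rightarrow> nat" where
  "graph_dist E u v = (LEAST k. \<exists>xs. walk_betw E u xs v \<and> length xs = Suc k)"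

definition diameter :: "'v::finite set set \<Rightarrow> nat" where
  "diameter E = Max (range (\<lambda>(u, v). graph_dist E u v))"

definition vertex_degree :: "'v set set \<Rightarrow> 'v \<Rightarrow> nat" where
  "vertex_degree E v = card {e \<in> E. v \<in> e}"

definition pendant_vertices :: "'v set set \<Rightarrow> 'v set" where
  "pendant_vertices E = {v. vertex_degree E v = 1}"


section \<open>The standard graded polynomial ring on the vertices\<close>

text \<open>
  The polynomial ring over \<open>'k\<close> whose variables are the elements of \<open>'v\<close>: a monomial is its
  exponent vector, a polynomial is a finitely supported family of coefficients, and the product
  of \<^theory>\<open>HOL-Library.Poly_Mapping\<close> is the usual convolution.
\<close>

type_synonym ('v, 'k) mpoly = "('v \<Rightarrow>\<^sub>0 nat) \<Rightarrow>\<^sub>0 'k"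

definition Var :: "'v \<Rightarrow> ('v, 'k::comm_ring_1) mpoly" where
  "Var v = Poly_Mapping.single (Poly_Mapping.single v 1) 1"

definition monom_degree :: "('v \<Rightarrow>\<^sub>0 nat) \<Rightarrow> nat" where
  "monom_degree m = (\<Sum>v\<in>Poly_Mapping.keys m. Poly_Mapping.lookup m v)"

text \<open>The zero polynomial is homogeneous of every degree, and it is the only polynomial that is
  homogeneous of a negative degree.\<close>

definition homogeneous :: "int \<Rightarrow> ('v, 'k::comm_ring_1) mpoly \<Rightarrow> bool" where
  "homogeneous j f \<longleftrightarrow> (\<forall>m\<in>Poly_Mapping.keys f. int (monom_degree m) = j)"

definition ideal_generated :: "('v, 'k::comm_ring_1) mpoly set \<Rightarrow> ('v, 'k) mpoly set" where
  "ideal_generated B = Modules.module.span (*) B"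

definition irrelevant_ideal :: "('v, 'k::comm_ring_1) mpoly set" where
  "irrelevant_ideal = ideal_generated (range Var)"

definition edge_ideal :: "'v set set \<Rightarrow> ('v, 'k::comm_ring_1) mpoly set" where
  "edge_ideal E = ideal_generated {Var x * Var y | x y. {x, y} \<in> E}"


section \<open>Minimal graded free resolutions, Betti numbers and regularity of S/I\<close>

text \<open>
  The data of a complex of finitely generated graded free modules augmented to \<open>S/I\<close>,
  \[ \cdots \to F_2 \to F_1 \to F_0 \to S/I \to 0 . \]
  \<^item> \<open>shifts C i\<close> lists the degrees of the basis of \<open>F\<^sub>i\<close>, that is,
    \<open>F\<^sub>i\<close> is the direct sum of the modules \<open>S(-j)\<close> for \<open>j\<close> in this list (with repetitions).
  \<^item> \<open>bd C i\<close>, for \<open>i \<ge> 1\<close>, is the matrix of the map from \<open>F\<^sub>i\<close> to \<open>F\<^sub>i\<^sub>-\<^sub>1\<close>, acting on column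
    vectors; \<open>bd C 0\<close> is not used.
  \<^item> \<open>aug C\<close> consists of representatives in \<open>S\<close> of the images of the basis of \<open>F\<^sub>0\<close> in \<open>S/I\<close>, so that
    the augmentation maps \<open>w\<close> to the class of \<open>aug C \<bullet> w\<close> modulo \<open>I\<close>.
\<close>

record (overloaded) ('v, 'k::zero) graded_complex =
  shifts :: "nat \<Rightarrow> int list"
  bd :: "nat \<Rightarrow> ('v, 'k) mpoly mat"
  aug :: "('v, 'k) mpoly vec"

abbreviation free_module :: "('v, 'k::field) graded_complex \<Rightarrow> nat \<Rightarrow> ('v, 'k) mpoly vec set" where
  "free_module C i \<equiv> carrier_vec (length (shifts C i))"

text \<open>All maps are homogeneous of degree 0: an entry of a map sending a basis element of degree
  \<open>b\<close> to a multiple of one of degree \<open>a\<close> is homogeneous of degree \<open>b - a\<close>.\<close>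

definition graded_maps :: "('v, 'k::field) graded_complex \<Rightarrow> bool" where
  "graded_maps C \<longleftrightarrow>
     aug C \<in> free_module C 0 \<and>
     (\<forall>c<length (shifts C 0). homogeneous (shifts C 0 ! c) (aug C $ c)) \<and>
     (\<forall>i. bd C (Suc i) \<in> carrier_mat (length (shifts C i)) (length (shifts C (Suc i))) \<and>
          (\<forall>r<length (shifts C i). \<forall>c<length (shifts C (Suc i)).
             homogeneous (shifts C (Suc i) ! c - shifts C i ! r) (bd C (Suc i) $$ (r, c))))"

text \<open>Exactness at \<open>S/I\<close>, at \<open>F\<^sub>0\<close>, and at \<open>F\<^sub>i\<^sub>+\<^sub>1\<close>, respectively.\<close>

definition exact_complex :: "('v, 'k::field) mpoly set \<Rightarrow> ('v, 'k) graded_complex \<Rightarrow> bool" where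
  "exact_complex I C \<longleftrightarrow>
     (\<forall>f. \<exists>w\<in>free_module C 0. f - aug C \<bullet> w \<in> I) \<and>
     {w \<in> free_module C 0. aug C \<bullet> w \<in> I} = (\<lambda>w. bd C 1 *\<^sub>v w) ` free_module C 1 \<and>
     (\<forall>i. {w \<in> free_module C (Suc i). bd C (Suc i) *\<^sub>v w = 0\<^sub>v (length (shifts C i))}
          = (\<lambda>w. bd C (Suc (Suc i)) *\<^sub>v w) ` free_module C (Suc (Suc i)))"

text \<open>Minimality: the image of \<open>F\<^sub>i\<^sub>+\<^sub>1\<close> is contained in the irrelevant ideal times \<open>F\<^sub>i\<close>.\<close>

definition minimal_complex :: "('v, 'k::field) graded_complex \<Rightarrow> bool" where
  "minimal_complex C \<longleftrightarrow>
     (\<forall>i. \<forall>r<length (shifts C i). \<forall>c<length (shifts C (Suc i)).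
        bd C (Suc i) $$ (r, c) \<in> irrelevant_ideal)"

text \<open>Resolutions have finite length; for finitely many variables this is no restriction on minimal
  graded free resolutions, by Hilbert's syzygy theorem.\<close>

definition minimal_graded_free_resolution ::
    "('v, 'k::field) mpoly set \<Rightarrow> ('v, 'k) graded_complex \<Rightarrow> bool" where
  "minimal_graded_free_resolution I C \<longleftrightarrow>
     graded_maps C \<and> exact_complex I C \<and> minimal_complex C \<and> (\<exists>l. \<forall>i>l. shifts C i = [])"

text \<open>The graded Betti numbers of \<open>S/I\<close>, for a homogeneous ideal \<open>I\<close>. The minimal graded free
  resolution is unique up to isomorphism, so the choice does not matter.\<close>

definition graded_betti :: "('v, 'k::field) mpoly set \<Rightarrow> nat \<Rightarrow> int \<Rightarrow> nat" where
  "graded_betti I i j = count_list (shifts (SOME C. minimal_graded_free_resolution I C) i) j"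

text \<open>The Castelnuovo-Mumford regularity of \<open>S/I\<close>, for a proper homogeneous ideal \<open>I\<close>.\<close>

definition reg_quotient :: "('v, 'k::field) mpoly set \<Rightarrow> int" where
  "reg_quotient I = Max {j - int i | i j. graded_betti I i j \<noteq> 0}"

end

theory Submission
  imports Defs
begin

text \<open>
  A greedy argument along longest paths produces, in every forest, an induced matching \<open>M\<close> together
  with equally many edges whose endpoints form a vertex cover. In a tree, each of these covering
  edges meets at most three edges of a geodesic, so \<open>d \<le> 3 |M|\<close>; and counting edges of a subforest
  shows that there are at most \<open>3 |M|\<close> vertices of degree at least two, so \<open>n - p \<le> 3 |M|\<close>. Hence
  \<open>n - p + d \<le> 6 |M|\<close>.

  It remains to see that the regularity is at least \<open>|M|\<close>. Any graded free resolution \<open>C\<close> of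
  \<open>S/I\<close> admits comparison maps from and to the Taylor resolution \<open>T\<close>. The composite \<open>T \<rightarrow> C \<rightarrow> T\<close>
  has constant term 1 at the diagonal entry of the basis element \<open>M\<close>, because \<open>M\<close> is induced; so
  \<open>C\<close> has a basis element of the same bidegree \<open>(|M|, 2|M|)\<close>. That a finite minimal resolution
  exists at all, so that the Betti numbers are not junk, follows by cancelling the unit entries of
  the Taylor resolution.
\<close>

subsection \<open>Induced matchings in forests\<close>

text \<open>The 5 in the numerator merely turns the floor into rounding up: once the numerator
  without it is at most \<open>6 |M|\<close>, the argument of the floor stays below
  \<open>|M| + 1\<close>. Matching and cover are built together because the cover controls both
  \<open>d\<close> and \<open>n - p\<close>, while the matching is what the regularity sees. The
  greedy step destroys connectedness, so it works with forests, given as edge sets over a fixed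
  vertex type, where isolated vertices do no harm. On the algebraic side the Betti numbers belong to
  a resolution selected by choice, so the lower bound has to hold for any finite graded resolution.
  The comparison maps respect only the standard grading, not the multigrading; degrees alone
  therefore do not determine the diagonal entry at \<open>M\<close>, and coefficients of single
  monomials are compared instead. All homological degrees share one finite basis, so that matrices
  of varying size enter only in the passage from and to the given notion of resolution.\<close>

definition forest :: "'v set set \<Rightarrow> bool" where
  "forest E \<longleftrightarrow> simple_graph E \<and> (\<nexists>xs. graph_cycle E xs)"

definition path_list :: "'v set set \<Rightarrow> 'v list \<Rightarrow> bool" where
  "path_list E xs \<longleftrightarrow> distinct xs \<and> successively (\<lambda>x y. {x, y} \<in> E) xs"

definition induced_matching :: "'v set set \<Rightarrow> 'v set set \<Rightarrow> bool" where
  "induced_matching E M \<longleftrightarrow> M \<subseteq> E \<and> (\<forall>e\<in>M. \<forall>f\<in>M. e \<noteq> f \<longrightarrow> e \<inter> f = {}) \<and> (\<forall>f\<in>E. f \<subseteq> \<Union>M \<longrightarrow> f \<in> M)"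

section \<open>Longest paths and leaves of forests\<close>

lemma simple_graph_other_end:
  assumes "simple_graph E" "e \<in> E" "x \<in> e"
  obtains y where "e = {x, y}" "y \<noteq> x"
proof -
  have "card e = 2" using assms unfolding simple_graph_def by blast
  then obtain a b where "e = {a, b}" "a \<noteq> b" by (auto simp: card_2_iff)
  then have "e = {x, b} \<and> b \<noteq> x \<or> e = {x, a} \<and> a \<noteq> x" using \<open>x \<in> e\<close> by blast
  then show thesis using that by blast
qed

lemma forest_subset: "forest E \<Longrightarrow> E' \<subseteq> E \<Longrightarrow> forest E'"
  unfolding forest_def simple_graph_def graph_cycle_def
  by (blast intro: successively_mono[where P = "\<lambda>x y. {x, y} \<in> E'"])

text \<open>If \<open>w\<close> sits further along the path, the segment from \<open>x\<close> to
  \<open>w\<close> together with the chord is a cycle; some vertex lies between them, which gives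
  the three vertices that a cycle requires.\<close>

lemma no_chord:
  assumes "forest E" "path_list E (x # ys)" "w \<in> set ys" "{x, w} \<in> E"
  shows "w = hd ys"
proof (rule ccontr)
  assume ne: "w \<noteq> hd ys"
  obtain as bs where ys: "ys = as @ w # bs" using assms(3) by (meson split_list)
  have "as \<noteq> []" using ne ys by auto
  have "graph_cycle E (x # as @ [w])"
    using assms(2,4) \<open>as \<noteq> []\<close> unfolding graph_cycle_def path_list_def ys
    by (auto simp: successively_Cons successively_append_iff insert_commute Suc_le_eq)
  then show False using assms(1) unfolding forest_def by blast
qed

text \<open>A neighbour of \<open>x\<close> off the path would prolong it, and a neighbour on the
  path beyond \<open>y\<close> would be a chord.\<close>

lemma longest_path_end:
  assumes "forest E" "path_list E (x # y # ys)"
    and longest: "\<And>zs. path_list E zs \<Longrightarrow> length zs \<le> length (x # y # ys)"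
    and "e \<in> E" "x \<in> e"
  shows "e = {x, y}"
proof -
  obtain w where w: "e = {x, w}" "w \<noteq> x"
    using simple_graph_other_end assms(1,4,5) unfolding forest_def by metis
  have "w \<in> set (y # ys)"
  proof (rule ccontr)
    assume "w \<notin> set (y # ys)"
    then have "path_list E (w # x # y # ys)"
      using assms(2,4) w unfolding path_list_def by (auto simp: insert_commute)
    from longest[OF this] show False by simp
  qed
  then have "w = y" using no_chord[OF assms(1,2)] assms(4) w by auto
  then show ?thesis using w by simp
qed

text \<open>Take \<open>l\<close>, \<open>u\<close>, \<open>v\<close> as the first three vertices of
  a longest path. Any further neighbour of \<open>u\<close> can replace \<open>l\<close> without
  changing the length, so it also ends a longest path and is a leaf.\<close>

lemma forest_end:
  fixes E :: "'v::finite set set"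
  assumes f: "forest E" and "E \<noteq> {}"
  shows "\<exists>l u v. {l, u} \<in> E \<and> l \<noteq> u \<and> {u, v} \<in> E \<and> (\<forall>e\<in>E. l \<in> e \<longrightarrow> e = {l, u}) \<and>
    (\<forall>w. {u, w} \<in> E \<longrightarrow> w \<noteq> v \<longrightarrow> (\<forall>e\<in>E. w \<in> e \<longrightarrow> e = {u, w}))"
proof -
  obtain e0 where e0: "e0 \<in> E" using assms by blast
  then obtain a b where ab: "e0 = {a, b}" "a \<noteq> b"
    using f unfolding forest_def simple_graph_def by (metis card_2_iff)
  have p0: "path_list E [a, b]" using e0 ab by (auto simp: path_list_def)
  have bd: "\<forall>zs. path_list E zs \<longrightarrow> length zs < Suc CARD('v)"
    unfolding path_list_def by (metis card_mono distinct_card finite_class.finite_UNIV less_Suc_eq_le subset_UNIV)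
  obtain xs where xs: "path_list E xs" and longest: "\<And>zs. path_list E zs \<Longrightarrow> length zs \<le> length xs"
    using ex_has_greatest_nat[of "path_list E", OF p0 bd] by blast
  have "length xs \<ge> 2" using longest[OF p0] by simp
  then obtain x y ys where X: "xs = x # y # ys"
    by (metis One_nat_def Suc_1 Suc_le_length_iff length_Suc_conv_rev list.exhaust_sel)
  \<comment> \<open>A longest path with a single edge has no third vertex; falling back on
    \<open>x\<close> keeps \<open>{y, v}\<close> an edge.\<close>
  define v where "v = (if ys = [] then x else hd ys)"
  have xy: "{x, y} \<in> E" "x \<noteq> y" and yv: "{y, v} \<in> E"
    using xs unfolding X path_list_def v_def by (auto simp: successively_Cons insert_commute)
  have leaf: "e = {x, y}" if "e \<in> E" "x \<in> e" for e
    using longest_path_end[OF f xs[unfolded X]] longest that unfolding X by blast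
  have "e = {y, w}" if w: "{y, w} \<in> E" "w \<noteq> v" and e: "e \<in> E" "w \<in> e" for w e
  proof (cases "w = x")
    case True
    then show ?thesis using leaf e by (auto simp: insert_commute)
  next
    case False
    have pt: "path_list E (y # ys)" using xs unfolding X path_list_def by auto
    have wy: "w \<noteq> y" using w f unfolding forest_def simple_graph_def by force
    have "w \<notin> set ys"
      using no_chord[OF f pt] w unfolding v_def by (metis empty_iff empty_set)
    then have "path_list E (w # y # ys)"
      using pt wy w unfolding path_list_def by (auto simp: insert_commute)
    then have "e = {w, y}" using longest_path_end[OF f] longest e unfolding X
      by (metis length_Cons)
    then show ?thesis by (simp add: insert_commute)
  qed
  then show ?thesis using xy yv leaf by blast
qed

text \<open>A leaf and its only edge are removed together, so edges and vertices decrease by one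
  each. \<open>V\<close> may exceed \<open>\<Union>E\<close> because the neighbour of the leaf can
  become isolated.\<close>

lemma forest_card_le:
  fixes E :: "'v::finite set set"
  assumes "forest E" "\<Union>E \<subseteq> V"
  shows "card E \<le> card V"
  using finite[of E] assms
proof (induction E arbitrary: V rule: finite_psubset_induct)
  case (psubset E)
  show ?case
  proof (cases "E = {}")
    case False
    obtain l u where lu: "{l, u} \<in> E" and leaf: "\<And>e. e \<in> E \<Longrightarrow> l \<in> e \<Longrightarrow> e = {l, u}"
      using forest_end[OF psubset.prems(1) False] by blast
    have "card (E - {{l, u}}) \<le> card (V - {l})"
    proof (rule psubset.IH)
      show "E - {{l, u}} \<subset> E" using lu by blast
      show "forest (E - {{l, u}})" by (rule forest_subset[OF psubset.prems(1)]) blast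
      show "\<Union>(E - {{l, u}}) \<subseteq> V - {l}" using psubset.prems(2) leaf by blast
    qed
    moreover have "l \<in> V" using lu psubset.prems(2) by blast
    moreover have "card V = Suc (card (V - {l}))" "card E = Suc (card (E - {{l, u}}))"
      by (metis card_Suc_Diff1 finite \<open>l \<in> V\<close>) (metis card_Suc_Diff1 finite lu)
    ultimately show ?thesis by linarith
  qed simp
qed

text \<open>The greedy step at the end of a longest path \<open>l, u, v, \<dots>\<close>: the matching edge \<open>{l, u}\<close> is
  paid for by the edge \<open>{u, v}\<close>, whose endpoints meet every edge close to \<open>{l, u}\<close>.\<close>

lemma forest_matching_cover:
  fixes E :: "'v::finite set set"
  assumes "forest E"
  obtains M F where "induced_matching E M" "F \<subseteq> E" "card F = card M" "\<And>e. e \<in> E \<Longrightarrow> e \<inter> \<Union>F \<noteq> {}"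
proof -
  have "\<exists>M F. induced_matching E M \<and> F \<subseteq> E \<and> card F = card M \<and> (\<forall>e\<in>E. e \<inter> \<Union>F \<noteq> {})"
    using finite[of E] assms
  proof (induction E rule: finite_psubset_induct)
    case (psubset E)
    show ?case
    proof (cases "E = {}")
      case True
      then show ?thesis by (auto simp: induced_matching_def)
    next
      case False
      obtain l u v where lu: "{l, u} \<in> E" "l \<noteq> u" and uv: "{u, v} \<in> E"
        and leaf': "\<forall>e\<in>E. l \<in> e \<longrightarrow> e = {l, u}"
        and nbr': "\<forall>w. {u, w} \<in> E \<longrightarrow> w \<noteq> v \<longrightarrow> (\<forall>e\<in>E. w \<in> e \<longrightarrow> e = {u, w})"
        using forest_end[OF psubset.prems False] by metis
      note leaf = leaf'[rule_format] and nbr = nbr'[rule_format]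
      \<comment> \<open>Every edge at \<open>l\<close> is \<open>{l, u}\<close>, so this discards
        exactly the edges met by \<open>{u, v}\<close>, and what remains avoids \<open>l\<close> as
        well.\<close>
      define E' where "E' = {e \<in> E. u \<notin> e \<and> v \<notin> e}"
      have E': "E' \<subset> E" "forest E'"
      proof -
        have "E' \<subseteq> E" "{l, u} \<notin> E'" unfolding E'_def by auto
        then show "E' \<subset> E" "forest E'" using lu(1) forest_subset[OF psubset.prems] by auto
      qed
      obtain M F where IH: "induced_matching E' M" "F \<subseteq> E'" "card F = card M"
        "\<forall>e\<in>E'. e \<inter> \<Union>F \<noteq> {}"
        using psubset.IH[OF E'] by metis
      have M: "M \<subseteq> E'" using IH unfolding induced_matching_def by blast
      have avoid: "u \<notin> e" "v \<notin> e" "l \<notin> e" "e \<in> E" if "e \<in> M" for e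
        using that M leaf unfolding E'_def by auto
      have "induced_matching E (insert {l, u} M)"
        unfolding induced_matching_def
      proof (intro conjI ballI impI)
        show "insert {l, u} M \<subseteq> E" using avoid lu by blast
        show "e \<inter> f = {}" if "e \<in> insert {l, u} M" "f \<in> insert {l, u} M" "e \<noteq> f" for e f
        proof -
          have "e \<inter> f = {}" if "e \<in> M" "f \<in> M" "e \<noteq> f" for e f
            using that IH(1) unfolding induced_matching_def by blast
          moreover have "{l, u} \<inter> e = {}" if "e \<in> M" for e using avoid[OF that] by auto
          ultimately show ?thesis using that by (metis Int_commute insertE)
        qed
        show "f \<in> insert {l, u} M" if f: "f \<in> E" "f \<subseteq> \<Union>(insert {l, u} M)" for f
        proof (cases "l \<in> f \<or> u \<in> f")
          case True
          show ?thesis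
          proof (cases "l \<in> f")
            case False
            then have "u \<in> f" using True by blast
            obtain w where w: "f = {u, w}" "w \<noteq> u"
              using simple_graph_other_end[OF _ f(1) \<open>u \<in> f\<close>] psubset.prems
              unfolding forest_def by metis
            then obtain e where e: "e \<in> M" "w \<in> e" using f(2) False by auto
            \<comment> \<open>\<open>w\<close> lies on a matching edge, so it differs from
              \<open>v\<close>; as a neighbour of \<open>u\<close> it is then a leaf, and the
              matching edge would have to pass through \<open>u\<close>.\<close>
            then have "e = {u, w}" using nbr[of w e] avoid[OF e(1)] w f by auto
            then show ?thesis using avoid(1)[OF e(1)] by auto
          qed (use leaf f in blast)
        next
          case False
          then have "f \<subseteq> \<Union>M" using f(2) by auto
          moreover then have "f \<in> E'" using False f(1) avoid unfolding E'_def by auto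
          ultimately show ?thesis using IH(1) unfolding induced_matching_def by blast
        qed
      qed
      moreover have "insert {u, v} F \<subseteq> E" using uv IH(2) E' by blast
      moreover have "card (insert {u, v} F) = card (insert {l, u} M)"
        using IH(2,3) avoid(1) by (subst (1 2) card_insert_disjoint) (auto simp: E'_def)
      moreover have "e \<inter> \<Union>(insert {u, v} F) \<noteq> {}" if "e \<in> E" for e
        using bspec[OF IH(4), of e] that unfolding E'_def by auto
      ultimately show ?thesis by blast
    qed
  qed
  then show thesis using that by metis
qed

section \<open>Diameter and inner vertices against a cover by edges\<close>

text \<open>Otherwise leaving out the stretch between the two positions gives a shorter walk with
  the same ends, contradicting the \<open>LEAST\<close> in \<open>graph_dist\<close>.\<close>

lemma geodesic_no_shortcut:
  assumes xs: "walk_betw E u xs v" "length xs = Suc (graph_dist E u v)"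
    and "s < t" "t < length xs" "xs ! s = xs ! t \<or> {xs ! s, xs ! t} \<in> E"
  shows "t \<le> Suc s"
proof (rule ccontr)
  assume t: "\<not> t \<le> Suc s"
  \<comment> \<open>When the two vertices coincide, the tail starts one position later so that the
    vertex is not repeated; if \<open>t\<close> is the last position, this tail is empty and the new
    walk ends at \<open>xs ! s\<close>.\<close>
  define t' where "t' = (if xs ! s = xs ! t then Suc t else t)"
  define zs where "zs = take (Suc s) xs @ drop t' xs"
  have ne: "take (Suc s) xs \<noteq> []" and lt: "last (take (Suc s) xs) = xs ! s"
    using assms(3,4) by (auto simp: take_Suc_conv_app_nth)
  have succ: "{xs ! i, xs ! Suc i} \<in> E" if "Suc i < length xs" for i
  proof -
    have "successively (\<lambda>x y. {x, y} \<in> E) (drop i xs)"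
      using xs(1) successively_append_iff[of _ "take i xs" "drop i xs"] unfolding walk_betw_def
      by auto
    moreover have "drop i xs = xs ! i # xs ! Suc i # drop (Suc (Suc i)) xs"
      using that by (metis Cons_nth_drop_Suc Suc_lessD)
    ultimately show ?thesis by simp
  qed
  have "walk_betw E u zs v"
    unfolding walk_betw_def
  proof (intro conjI)
    show "zs \<noteq> []" using ne by (simp add: zs_def)
    show "hd zs = u" using xs(1) ne unfolding walk_betw_def zs_def by auto
    show "last zs = v"
    proof (cases "t' < length xs")
      case True
      then show ?thesis using xs(1) unfolding walk_betw_def zs_def by simp
    next
      case False
      then have "xs ! s = xs ! t" "t = length xs - 1" using assms(4) unfolding t'_def
        by (auto split: if_splits)
      then show ?thesis using xs(1) False lt unfolding walk_betw_def zs_def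
        by (simp add: last_conv_nth) (metis last_conv_nth One_nat_def)
    qed
    have "{xs ! s, xs ! t'} \<in> E" if "t' < length xs"
      using that assms(5) succ[of t] unfolding t'_def by (auto split: if_splits)
    then have "{last (take (Suc s) xs), hd (drop t' xs)} \<in> E" if "drop t' xs \<noteq> []"
      using that lt by (simp add: hd_drop_conv_nth)
    moreover have "successively (\<lambda>x y. {x, y} \<in> E) (take k xs)"
      "successively (\<lambda>x y. {x, y} \<in> E) (drop k xs)" for k
      using xs(1) successively_append_iff[of _ "take k xs" "drop k xs"] unfolding walk_betw_def
      by auto
    ultimately show "successively (\<lambda>x y. {x, y} \<in> E) zs"
      unfolding zs_def successively_append_iff by blast
  qed
  moreover have "length zs < length xs"
    using t assms(3,4) unfolding zs_def t'_def by auto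
  moreover have "length zs \<noteq> 0" using ne by (simp add: zs_def)
  ultimately have "walk_betw E u zs v \<and> length zs = Suc (length zs - 1)" "length zs - 1 < graph_dist E u v"
    using xs(2) by linarith+
  then show False unfolding graph_dist_def using not_less_Least by blast
qed

text \<open>The 3 counts the geodesic edges that one edge can meet. Two vertices of an edge
  \<open>f\<close> of \<open>F\<close> are equal or adjacent, so their positions on a geodesic
  differ by at most one; a geodesic edge meeting \<open>f\<close> starts at such a position or one
  earlier, which leaves a window of three starting indices.\<close>

lemma diameter_le_cover:
  fixes E :: "'v::finite set set"
  assumes "connected_graph E" "F \<subseteq> E" "\<And>e. e \<in> F \<Longrightarrow> card e = 2"
    and cover: "\<And>e. e \<in> E \<Longrightarrow> e \<inter> \<Union>F \<noteq> {}"
  shows "diameter E \<le> 3 * card F"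
proof -
  have "diameter E \<in> range (\<lambda>(u, v). graph_dist E u v)"
    unfolding diameter_def by (rule Max_in) auto
  then obtain u v where d: "diameter E = graph_dist E u v" by auto
  obtain ys where ys: "walk_betw E u ys v" using assms(1) unfolding connected_graph_def by blast
  then have "\<exists>k zs. walk_betw E u zs v \<and> length zs = Suc k"
    unfolding walk_betw_def by (metis Suc_pred length_greater_0_conv)
  then have "\<exists>zs. walk_betw E u zs v \<and> length zs = Suc (graph_dist E u v)"
    unfolding graph_dist_def by (rule LeastI_ex)
  then obtain xs where xs: "walk_betw E u xs v" "length xs = Suc (graph_dist E u v)" by blast
  have edge: "{xs ! i, xs ! Suc i} \<in> E" if "i < diameter E" for i
    using that xs unfolding d walk_betw_def by (simp add: successively_conv_nth)
  define S where "S f = {i. i < diameter E \<and> f \<inter> {xs ! i, xs ! Suc i} \<noteq> {}}" for f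
  have S3: "card (S f) \<le> 3" if f: "f \<in> F" for f
  proof (cases "S f = {}")
    case False
    have close: "j \<le> i + 2" if i: "i \<in> S f" and j: "j \<in> S f" for i j
    proof -
      obtain s where s: "xs ! s \<in> f" "s = i \<or> s = Suc i" using i unfolding S_def by blast
      obtain t where t: "xs ! t \<in> f" "t = j \<or> t = Suc j" using j unfolding S_def by blast
      have tl: "t < length xs" using t(2) j xs(2) unfolding S_def d by auto
      have "xs ! s = xs ! t \<or> {xs ! s, xs ! t} = f"
        using s(1) t(1) assms(3)[OF f] by (auto simp: card_2_iff)
      then have "xs ! s = xs ! t \<or> {xs ! s, xs ! t} \<in> E" using f assms(2) by auto
      then have "s < t \<Longrightarrow> t \<le> Suc s" using geodesic_no_shortcut[OF xs _ tl] by blast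
      then show ?thesis using s(2) t(2) by linarith
    qed
    have fin: "finite (S f)" unfolding S_def by simp
    define k where "k = Min (S f)"
    have "S f \<subseteq> {k..k + 2}"
      using close Min_in[OF fin False] Min_le[OF fin] unfolding k_def by fastforce
    then have "card (S f) \<le> card {k..k + 2}" by (intro card_mono) auto
    then show ?thesis by simp
  qed simp
  have "{..<diameter E} \<subseteq> (\<Union>f\<in>F. S f)"
    using cover[OF edge] unfolding S_def by blast
  then have "card {..<diameter E} \<le> card (\<Union>f\<in>F. S f)"
    by (rule card_mono[rotated]) (auto simp: S_def)
  also have "\<dots> \<le> (\<Sum>f\<in>F. card (S f))" by (rule card_UN_le) simp
  also have "\<dots> \<le> (\<Sum>f\<in>F. 3)" by (intro sum_mono S3)
  finally show ?thesis by simp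
qed

text \<open>Let \<open>W\<close> be the endpoints of \<open>F\<close> and \<open>X\<close> the other
  vertices of degree at least two. Every edge meets \<open>W\<close>, so \<open>X\<close> is
  independent and at least \<open>2 |X|\<close> edges join it to \<open>W\<close>, none of them in
  \<open>F\<close>. Together with \<open>F\<close> they form a forest on
  \<open>W \<union> X\<close>, whence \<open>|F| + 2 |X| \<le> |W| + |X|\<close>. With
  \<open>|W| \<le> 2 |F|\<close> this gives \<open>|X| \<le> |F|\<close> and
  \<open>|W| + |X| \<le> 3 |F|\<close>.\<close>

lemma inner_vertices_le_cover:
  fixes E :: "'v::finite set set"
  assumes "forest E" "F \<subseteq> E" and cover: "\<And>e. e \<in> E \<Longrightarrow> e \<inter> \<Union>F \<noteq> {}"
  shows "card {v. vertex_degree E v \<ge> 2} \<le> 3 * card F"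
proof -
  define W where "W = \<Union>F"
  define X where "X = {v. vertex_degree E v \<ge> 2} - W"
  define G where "G = F \<union> (\<Union>x\<in>X. {e \<in> E. x \<in> e})"
  have c2: "card e = 2" if "e \<in> E" for e
    using assms(1) that unfolding forest_def simple_graph_def by blast
  have W: "card W \<le> 2 * card F"
  proof -
    have "card W \<le> (\<Sum>e\<in>F. card e)" unfolding W_def by (rule card_Union_le_sum_card)
    also have "\<dots> = (\<Sum>e\<in>F. 2)" using c2 assms(2) by (intro sum.cong) auto
    finally show ?thesis by simp
  qed
  have XW: "e \<subseteq> insert x W" if ex: "e \<in> E" "x \<in> e" "x \<in> X" for e x
  proof -
    obtain y where y: "e = {x, y}"
      using simple_graph_other_end[OF _ ex(1,2)] assms(1) unfolding forest_def by blast
    then show ?thesis using cover[OF ex(1)] ex(3) unfolding X_def W_def by auto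
  qed
  have "card (\<Union>x\<in>X. {e \<in> E. x \<in> e}) = (\<Sum>x\<in>X. card {e \<in> E. x \<in> e})"
    using XW by (intro card_UN_disjoint) (auto simp: X_def)
  also have "\<dots> \<ge> (\<Sum>x\<in>X. 2)"
    by (intro sum_mono) (auto simp: X_def vertex_degree_def)
  finally have "2 * card X \<le> card (\<Union>x\<in>X. {e \<in> E. x \<in> e})" by simp
  moreover have "card G = card F + card (\<Union>x\<in>X. {e \<in> E. x \<in> e})"
    unfolding G_def by (intro card_Un_disjoint) (auto simp: X_def W_def)
  moreover have "card G \<le> card (W \<union> X)"
  proof (rule forest_card_le)
    show "forest G" using assms(1,2) by (auto simp: G_def intro: forest_subset)
    show "\<Union>G \<subseteq> W \<union> X" using XW unfolding G_def W_def by blast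
  qed
  moreover have "card (W \<union> X) = card W + card X" by (rule card_Un_disjoint) (auto simp: X_def)
  moreover have "card {v. vertex_degree E v \<ge> 2} \<le> card (W \<union> X)"
    by (intro card_mono) (auto simp: X_def)
  ultimately show ?thesis using W by linarith
qed

lemma connected_degree_pos:
  fixes E :: "'v::finite set set"
  assumes "connected_graph E" "CARD('v) \<ge> 2"
  shows "vertex_degree E v \<ge> 1"
proof -
  have "\<exists>w. w \<noteq> v"
  proof (rule ccontr)
    assume "\<nexists>w. w \<noteq> v"
    then have "(UNIV :: 'v set) = {v}" by auto
    then show False using assms(2) by (metis card_1_singleton_iff One_nat_def numeral_le_one_iff semiring_norm(69))
  qed
  then obtain w where "w \<noteq> v" by blast
  obtain xs where xs: "walk_betw E v xs w" using assms(1) unfolding connected_graph_def by blast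
  then obtain y ys where "xs = v # y # ys"
    using \<open>w \<noteq> v\<close> unfolding walk_betw_def by (metis last_ConsL list.collapse)
  then have "{v, y} \<in> E" using xs unfolding walk_betw_def by simp
  then have "{e \<in> E. v \<in> e} \<noteq> {}" by blast
  then show ?thesis unfolding vertex_degree_def by (metis One_nat_def Suc_leI card_gt_0_iff finite)
qed

lemma tree_induced_matching:
  fixes E :: "'v::finite set set"
  assumes "is_tree E" "CARD('v) \<ge> 2"
  obtains M where "induced_matching E M" "CARD('v) + diameter E \<le> 6 * card M + card (pendant_vertices E)"
proof -
  have f: "forest E" and c: "connected_graph E" using assms(1) unfolding is_tree_def forest_def by auto
  obtain M F where M: "induced_matching E M" and F: "F \<subseteq> E" "card F = card M" "\<And>e. e \<in> E \<Longrightarrow> e \<inter> \<Union>F \<noteq> {}"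
    using forest_matching_cover[OF f] by metis
  have "diameter E \<le> 3 * card F"
    using diameter_le_cover[OF c F(1) _ F(3)] F(1) f unfolding forest_def simple_graph_def by blast
  moreover have "card {v. vertex_degree E v \<ge> 2} \<le> 3 * card F"
    by (rule inner_vertices_le_cover[OF f F(1,3)])
  \<comment> \<open>There are no isolated vertices, so degree one and degree at least two exhaust
    all cases; this is where \<open>n \<ge> 2\<close> enters.\<close>
  moreover have "CARD('v) = card {v. vertex_degree E v \<ge> 2} + card (pendant_vertices E)"
  proof -
    have "(UNIV :: 'v set) = {v. vertex_degree E v \<ge> 2} \<union> pendant_vertices E"
      using connected_degree_pos[OF c assms(2)] unfolding pendant_vertices_def
      by (auto simp: le_Suc_eq numeral_2_eq_2) (metis One_nat_def le_antisym not_less_eq_eq)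
    moreover have "card \<dots> = card {v. vertex_degree E v \<ge> 2} + card (pendant_vertices E)"
      by (rule card_Un_disjoint) (auto simp: pendant_vertices_def)
    ultimately show ?thesis by metis
  qed
  ultimately show thesis using that M F(2) by auto
qed

subsection \<open>Coefficients and homogeneous components\<close>

abbreviation coef :: "('a \<Rightarrow>\<^sub>0 'b::zero) \<Rightarrow> 'a \<Rightarrow> 'b" where
  "coef \<equiv> Poly_Mapping.lookup"

abbreviation mterm :: "'a \<Rightarrow> 'b \<Rightarrow> 'a \<Rightarrow>\<^sub>0 'b::zero" where
  "mterm \<equiv> Poly_Mapping.single"

lemma poly_expand: "f = (\<Sum>m\<in>Poly_Mapping.keys f. mterm m (coef f m))"
proof (rule poly_mapping_eqI)
  fix k
  have "coef (\<Sum>m\<in>Poly_Mapping.keys f. mterm m (coef f m)) k = (\<Sum>m\<in>Poly_Mapping.keys f. if m = k then coef f m else 0)"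
    by (simp add: lookup_sum lookup_single when_def)
  also have "\<dots> = coef f k" by (simp add: in_keys_iff)
  finally show "coef f k = coef (\<Sum>m\<in>Poly_Mapping.keys f. mterm m (coef f m)) k" by simp
qed

text \<open>Subtraction of exponents is truncated, so divisibility of the monomials has to be tested
  separately.\<close>

lemma coef_mterm_mult:
  fixes f :: "('v, 'k::comm_ring_1) mpoly"
  shows "coef (mterm m a * f) k = (if \<forall>v. coef m v \<le> coef k v then a * coef f (k - m) else 0)"
proof -
  have eq: "m + n = k \<longleftrightarrow> (\<forall>v. coef m v \<le> coef k v) \<and> n = k - m" for n
    unfolding poly_mapping_eq_iff fun_eq_iff lookup_add lookup_minus
    by (metis add_diff_cancel_left' le_add1 le_add_diff_inverse)
  have "coef (mterm m a * f) k = coef (mterm m a * (\<Sum>n\<in>Poly_Mapping.keys f. mterm n (coef f n))) k"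
    using poly_expand[of f] by simp
  also have "\<dots> = (\<Sum>n\<in>Poly_Mapping.keys f. if m + n = k then a * coef f n else 0)"
    by (simp add: sum_distrib_left lookup_sum mult_single lookup_single when_def)
  also have "\<dots> = (\<Sum>n\<in>Poly_Mapping.keys f. if n = k - m then (if \<forall>v. coef m v \<le> coef k v then a * coef f n else 0) else 0)"
    by (intro sum.cong) (simp_all add: eq)
  also have "\<dots> = (if \<forall>v. coef m v \<le> coef k v then a * coef f (k - m) else 0)"
    by (simp add: in_keys_iff)
  finally show ?thesis .
qed

lemma coef_mult_0:
  fixes f g :: "('v, 'k::comm_ring_1) mpoly"
  shows "coef (f * g) 0 = coef f 0 * coef g 0"
proof -
  have z: "(\<forall>v. coef m v \<le> coef (0 :: 'v \<Rightarrow>\<^sub>0 nat) v) \<longleftrightarrow> m = 0" for m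
    by (auto simp: poly_mapping_eq_iff fun_eq_iff)
  have "coef (f * g) 0 = coef ((\<Sum>m\<in>Poly_Mapping.keys f. mterm m (coef f m)) * g) 0"
    using poly_expand[of f] by simp
  also have "\<dots> = (\<Sum>m\<in>Poly_Mapping.keys f. if m = 0 then coef f m * coef g 0 else 0)"
    unfolding sum_distrib_right lookup_sum coef_mterm_mult z by (intro sum.cong) auto
  also have "\<dots> = coef f 0 * coef g 0" by (simp add: in_keys_iff)
  finally show ?thesis .
qed

lemma monom_degree_UNIV:
  "monom_degree m = (\<Sum>v\<in>(UNIV :: 'v::finite set). coef m v)"
  unfolding monom_degree_def by (rule sum.mono_neutral_left) (auto simp: in_keys_iff)

lemma monom_degree_add: "monom_degree (m + n) = monom_degree m + monom_degree (n :: 'v::finite \<Rightarrow>\<^sub>0 nat)"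
  by (simp add: monom_degree_UNIV lookup_add sum.distrib)

lemma monom_degree_eq_0: "monom_degree (m :: 'v::finite \<Rightarrow>\<^sub>0 nat) = 0 \<longleftrightarrow> m = 0"
  by (auto simp: monom_degree_UNIV poly_mapping_eq_iff fun_eq_iff)

definition hcomp :: "int \<Rightarrow> ('v, 'k::comm_ring_1) mpoly \<Rightarrow> ('v, 'k) mpoly" where
  "hcomp j f = Poly_Mapping.mapp (\<lambda>m a. if int (monom_degree m) = j then a else 0) f"

lemma coef_hcomp: "coef (hcomp j f) m = (if int (monom_degree m) = j then coef f m else 0)"
  by (auto simp: hcomp_def lookup_mapp when_def in_keys_iff)

lemma hcomp_add: "hcomp j (f + g) = hcomp j f + hcomp j g"
  by (rule poly_mapping_eqI) (simp add: coef_hcomp lookup_add)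

lemma hcomp_diff: "hcomp j (f - g) = hcomp j f - hcomp j g"
  by (rule poly_mapping_eqI) (simp add: coef_hcomp lookup_minus)

lemma hcomp_0 [simp]: "hcomp j 0 = 0"
  by (rule poly_mapping_eqI) (simp add: coef_hcomp)

lemma hcomp_sum: "hcomp j (\<Sum>x\<in>A. f x) = (\<Sum>x\<in>A. hcomp j (f x))"
  by (induction A rule: infinite_finite_induct) (simp_all add: hcomp_add)

lemma homogeneous_hcomp: "homogeneous j (hcomp j f)"
  by (auto simp: homogeneous_def in_keys_iff coef_hcomp split: if_splits)

lemma homogeneous_0 [simp]: "homogeneous j 0"
  by (simp add: homogeneous_def)

lemma hcomp_homogeneous: "homogeneous j f \<Longrightarrow> hcomp j f = f"
  by (rule poly_mapping_eqI) (auto simp: coef_hcomp homogeneous_def in_keys_iff)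

lemma hcomp_mterm_mult:
  fixes f :: "('v::finite, 'k::comm_ring_1) mpoly"
  shows "hcomp (int (monom_degree m) + e) (mterm m a * f) = mterm m a * hcomp e f"
proof (rule poly_mapping_eqI)
  fix k
  have "monom_degree k = monom_degree m + monom_degree (k - m)" if "\<forall>v. coef m v \<le> coef k v"
  proof -
    have "k = m + (k - m)" using that by (auto simp: poly_mapping_eq_iff fun_eq_iff lookup_add lookup_minus)
    then show ?thesis by (metis monom_degree_add)
  qed
  then show "coef (hcomp (int (monom_degree m) + e) (mterm m a * f)) k = coef (mterm m a * hcomp e f) k"
    by (auto simp: coef_hcomp coef_mterm_mult)
qed

text \<open>This lets an arbitrary solution of a linear equation with homogeneous coefficients be
  truncated to a homogeneous one. By linearity it reduces to multiplication by a single
  term.\<close>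

lemma hcomp_mult:
  fixes f g :: "('v::finite, 'k::comm_ring_1) mpoly"
  assumes "homogeneous d f"
  shows "hcomp (d + e) (f * g) = f * hcomp e g"
proof -
  have "hcomp (d + e) (f * g) = hcomp (d + e) ((\<Sum>m\<in>Poly_Mapping.keys f. mterm m (coef f m)) * g)"
    using poly_expand[of f] by simp
  also have "\<dots> = (\<Sum>m\<in>Poly_Mapping.keys f. hcomp (d + e) (mterm m (coef f m) * g))"
    by (simp add: sum_distrib_right hcomp_sum)
  also have "\<dots> = (\<Sum>m\<in>Poly_Mapping.keys f. mterm m (coef f m) * hcomp e g)"
    by (rule sum.cong) (use assms in \<open>auto simp: homogeneous_def simp flip: hcomp_mterm_mult\<close>)
  also have "\<dots> = f * hcomp e g"
    using poly_expand[of f] by (simp flip: sum_distrib_right)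
  finally show ?thesis .
qed

lemma homogeneous_add: "homogeneous j f \<Longrightarrow> homogeneous j g \<Longrightarrow> homogeneous j (f + g)"
  using Poly_Mapping.keys_add[of f g] unfolding homogeneous_def by blast

lemma homogeneous_uminus: "homogeneous j f \<Longrightarrow> homogeneous j (- f)"
  unfolding homogeneous_def by (simp add: in_keys_iff)

lemma homogeneous_diff: "homogeneous j f \<Longrightarrow> homogeneous j g \<Longrightarrow> homogeneous j (f - g)"
  using homogeneous_add[of j f "- g"] homogeneous_uminus[of j g] by simp

lemma homogeneous_sum: "(\<And>x. x \<in> A \<Longrightarrow> homogeneous j (f x)) \<Longrightarrow> homogeneous j (\<Sum>x\<in>A. f x)"
  by (induction A rule: infinite_finite_induct) (simp_all add: homogeneous_add)

lemma homogeneous_mult: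
  fixes f g :: "('v::finite, 'k::comm_ring_1) mpoly"
  assumes "homogeneous d f" "homogeneous e g"
  shows "homogeneous (d + e) (f * g)"
  using hcomp_mult[OF assms(1), of e g] homogeneous_hcomp[of "d + e" "f * g"]
  by (simp add: hcomp_homogeneous[OF assms(2)])

lemma homogeneous_mterm_0 [simp]: "homogeneous 0 (mterm 0 a)"
  by (simp add: homogeneous_def monom_degree_def)

text \<open>Only the zero exponent vector has degree 0. The lemma supplies the pivots for
  cancellation and later fixes the internal degree of the basis element that is sought.\<close>

lemma homogeneous_unit:
  fixes f :: "('v::finite, 'k::comm_ring_1) mpoly"
  assumes "homogeneous j f" "coef f 0 \<noteq> 0"
  shows "j = 0" "f = mterm 0 (coef f 0)"
proof -
  show "j = 0" using assms unfolding homogeneous_def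
    by (metis in_keys_iff monom_degree_eq_0 of_nat_0)
  then show "f = mterm 0 (coef f 0)"
    using assms(1) unfolding homogeneous_def
    by (intro poly_mapping_eqI) (metis in_keys_iff lookup_single_eq lookup_single_not_eq monom_degree_eq_0 of_nat_eq_0_iff)
qed

subsection \<open>Based resolutions\<close>

locale homogeneous_ideal =
  fixes I :: "('v::finite, 'k::field) mpoly set"
  assumes ideal_0: "0 \<in> I"
    and ideal_add: "f \<in> I \<Longrightarrow> g \<in> I \<Longrightarrow> f + g \<in> I"
    and ideal_mult: "g \<in> I \<Longrightarrow> f * g \<in> I"
    and ideal_hcomp: "f \<in> I \<Longrightarrow> hcomp j f \<in> I"
begin

lemma ideal_sum: "(\<And>x. x \<in> A \<Longrightarrow> f x \<in> I) \<Longrightarrow> (\<Sum>x\<in>A. f x) \<in> I"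
  by (induction A rule: infinite_finite_induct) (simp_all add: ideal_0 ideal_add)

end

text \<open>A finite graded free resolution of \<open>S/I\<close> whose basis elements, in all homological degrees
  at once, form the set \<open>B\<close>: \<open>hdeg\<close> and \<open>ideg\<close> are the homological and the internal degree,
  \<open>D s t\<close> is the coefficient at \<open>s\<close> of the boundary of \<open>t\<close>, and \<open>a\<close> is the augmentation. Elements
  of the total module are functions on \<open>B\<close>, whose values outside \<open>B\<close> are irrelevant.\<close>

locale based_resolution = homogeneous_ideal I for I :: "('v::finite, 'k::field) mpoly set" +
  fixes B :: "'b set" and hdeg :: "'b \<Rightarrow> nat" and ideg :: "'b \<Rightarrow> int"
    and D :: "'b \<Rightarrow> 'b \<Rightarrow> ('v, 'k) mpoly" and a :: "'b \<Rightarrow> ('v, 'k) mpoly"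
  assumes finite_B: "finite B"
    and D_hdeg: "\<And>s t. s \<in> B \<Longrightarrow> t \<in> B \<Longrightarrow> D s t \<noteq> 0 \<Longrightarrow> hdeg t = Suc (hdeg s)"
    and D_homogeneous: "\<And>s t. s \<in> B \<Longrightarrow> t \<in> B \<Longrightarrow> homogeneous (ideg t - ideg s) (D s t)"
    and a_hdeg: "\<And>t. t \<in> B \<Longrightarrow> a t \<noteq> 0 \<Longrightarrow> hdeg t = 0"
    and a_homogeneous: "\<And>t. t \<in> B \<Longrightarrow> homogeneous (ideg t) (a t)"
    and aD: "\<And>v. (\<Sum>s\<in>B. a s * (\<Sum>t\<in>B. D s t * v t)) \<in> I"
    and DD: "\<And>s v. s \<in> B \<Longrightarrow> (\<Sum>r\<in>B. D s r * (\<Sum>t\<in>B. D r t * v t)) = 0"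
    and exact: "\<And>v. (\<And>s. s \<in> B \<Longrightarrow> (\<Sum>t\<in>B. D s t * v t) = 0) \<Longrightarrow> (\<Sum>t\<in>B. a t * v t) \<in> I
      \<Longrightarrow> \<exists>u. \<forall>s\<in>B. v s = (\<Sum>t\<in>B. D s t * u t)"
    and onto: "\<exists>v. (\<Sum>t\<in>B. a t * v t) - 1 \<in> I"
begin

text \<open>Since \<open>t\<close> generates a copy of \<open>S(-ideg t)\<close>, these are the
  elements of internal degree \<open>d\<close> in the \<open>i\<close>-th free module.\<close>

definition bihomogeneous :: "nat \<Rightarrow> int \<Rightarrow> ('b \<Rightarrow> ('v, 'k) mpoly) \<Rightarrow> bool" where
  "bihomogeneous i d v \<longleftrightarrow> (\<forall>t\<in>B. (hdeg t \<noteq> i \<longrightarrow> v t = 0) \<and> homogeneous (d - ideg t) (v t))"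

lemma sum_D_indicator:
  assumes "t \<in> B"
  shows "(\<Sum>r\<in>B. D s r * (if r = t then 1 else 0)) = D s t"
  using assms finite_B by (simp add: if_distrib cong: if_cong)

lemma DD_matrix: "s \<in> B \<Longrightarrow> t \<in> B \<Longrightarrow> (\<Sum>r\<in>B. D s r * D r t) = 0"
  using DD[of s "\<lambda>r. if r = t then 1 else 0"] by (simp add: sum_D_indicator)

lemma aD_matrix: "t \<in> B \<Longrightarrow> (\<Sum>s\<in>B. a s * D s t) \<in> I"
  using aD[of "\<lambda>r. if r = t then 1 else 0"] by (simp add: sum_D_indicator)

text \<open>Exactness gives some preimage; its component in the expected bidegree is again a
  preimage because \<open>D\<close> and \<open>v\<close> are homogeneous.\<close>

lemma exact_bihomogeneous:
  assumes cycle: "\<And>s. s \<in> B \<Longrightarrow> (\<Sum>t\<in>B. D s t * v t) = 0" "(\<Sum>t\<in>B. a t * v t) \<in> I"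
    and v: "bihomogeneous i d v"
  obtains u where "bihomogeneous (Suc i) d u" "\<And>s. s \<in> B \<Longrightarrow> v s = (\<Sum>t\<in>B. D s t * u t)"
proof -
  obtain w where w: "\<And>s. s \<in> B \<Longrightarrow> v s = (\<Sum>t\<in>B. D s t * w t)"
    using exact[OF cycle] by blast
  define u where "u t = (if hdeg t = Suc i then hcomp (d - ideg t) (w t) else 0)" for t
  have "bihomogeneous (Suc i) d u"
    by (simp add: bihomogeneous_def u_def homogeneous_hcomp)
  moreover have "v s = (\<Sum>t\<in>B. D s t * u t)" if s: "s \<in> B" for s
  proof (cases "hdeg s = i")
    case True
    have "D s t * u t = hcomp (d - ideg s) (D s t * w t)" if t: "t \<in> B" for t
    proof (cases "D s t = 0")
      case False
      then show ?thesis
        using D_hdeg[OF s t] True hcomp_mult[OF D_homogeneous[OF s t], of "d - ideg t" "w t"]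
        by (simp add: u_def)
    qed simp
    then have "(\<Sum>t\<in>B. D s t * u t) = hcomp (d - ideg s) (v s)"
      unfolding w[OF s] by (simp add: hcomp_sum)
    then show ?thesis using v s by (simp add: bihomogeneous_def hcomp_homogeneous)
  next
    case False
    have "D s t * u t = 0" if t: "t \<in> B" for t
      using D_hdeg[OF s t] False by (cases "D s t = 0") (auto simp: u_def)
    then show ?thesis using v s False by (simp add: bihomogeneous_def)
  qed
  ultimately show thesis using that by blast
qed

text \<open>Multiply a preimage of 1 by \<open>f\<close> and keep the component of the right degree;
  the error stays in \<open>I\<close> because \<open>I\<close> is closed under components.\<close>

lemma onto_bihomogeneous:
  assumes f: "homogeneous d f"
  obtains v where "bihomogeneous 0 d v" "(\<Sum>t\<in>B. a t * v t) - f \<in> I"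
proof -
  obtain w where w: "(\<Sum>t\<in>B. a t * w t) - 1 \<in> I" using onto by blast
  define v where "v t = (if hdeg t = 0 then hcomp (d - ideg t) (f * w t) else 0)" for t
  have "bihomogeneous 0 d v" by (simp add: bihomogeneous_def v_def homogeneous_hcomp)
  moreover have "a t * v t = hcomp d (a t * (f * w t))" if t: "t \<in> B" for t
  proof (cases "a t = 0")
    case False
    then show ?thesis
      using a_hdeg[OF t] hcomp_mult[OF a_homogeneous[OF t], of "d - ideg t" "f * w t"]
      by (simp add: v_def)
  qed simp
  then have "(\<Sum>t\<in>B. a t * v t) - f = hcomp d (f * ((\<Sum>t\<in>B. a t * w t) - 1))"
    using f by (simp add: hcomp_sum hcomp_diff hcomp_homogeneous right_diff_distrib sum_distrib_left ac_simps)
  then have "(\<Sum>t\<in>B. a t * v t) - f \<in> I" using w by (simp add: ideal_hcomp ideal_mult)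
  ultimately show thesis using that by blast
qed

end

section \<open>Comparison of two resolutions\<close>

text \<open>The identity of \<open>S/I\<close> is lifted degree by degree: in degree 0 along the
  augmentation, and above because the part already constructed sends the boundary of
  \<open>b\<close> to a cycle, which is a boundary by exactness. \<open>\<phi> b\<close> is the
  column of the chain map at \<open>b\<close>.\<close>

lemma comparison_map:
  fixes B1 :: "'b set" and B2 :: "'c set" and I :: "('v::finite, 'k::field) mpoly set"
  assumes R1: "based_resolution I B1 h1 g1 D1 a1" and R2: "based_resolution I B2 h2 g2 D2 a2"
  obtains \<phi> where
    "\<And>b. b \<in> B1 \<Longrightarrow> based_resolution.bihomogeneous B2 h2 g2 (h1 b) (g1 b) (\<phi> b)"
    "\<And>b s. b \<in> B1 \<Longrightarrow> s \<in> B2 \<Longrightarrow> (\<Sum>t\<in>B2. D2 s t * \<phi> b t) = (\<Sum>t\<in>B1. D1 t b * \<phi> t s)"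
    "\<And>b. b \<in> B1 \<Longrightarrow> (\<Sum>t\<in>B2. a2 t * \<phi> b t) - a1 b \<in> I"
proof -
  interpret R1: based_resolution I B1 h1 g1 D1 a1 by (rule R1)
  interpret R2: based_resolution I B2 h2 g2 D2 a2 by (rule R2)
  define P where "P \<phi> b v \<longleftrightarrow> R2.bihomogeneous (h1 b) (g1 b) v \<and>
      (\<forall>s\<in>B2. (\<Sum>t\<in>B2. D2 s t * v t) = (\<Sum>t\<in>B1. D1 t b * \<phi> t s)) \<and>
      (\<Sum>t\<in>B2. a2 t * v t) - a1 b \<in> I" for \<phi> b v
  have step: "\<exists>v. P \<phi> b v" if b: "b \<in> B1" and IH: "\<forall>t\<in>B1. h1 t < h1 b \<longrightarrow> P \<phi> t (\<phi> t)" for \<phi> b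
  proof (cases "h1 b")
    case 0
    obtain v where v: "R2.bihomogeneous 0 (g1 b) v" "(\<Sum>t\<in>B2. a2 t * v t) - a1 b \<in> I"
      using R2.onto_bihomogeneous[OF R1.a_homogeneous[OF b]] by blast
    have "D2 s t * v t = 0" if "s \<in> B2" "t \<in> B2" for s t
      using R2.D_hdeg[OF that] v(1) that unfolding R2.bihomogeneous_def by fastforce
    moreover have "D1 t b = 0" if "t \<in> B1" for t
      using R1.D_hdeg[OF that b] 0 by auto
    ultimately have "P \<phi> b v" using v 0 unfolding P_def by simp
    then show ?thesis by blast
  next
    case (Suc i)
    \<comment> \<open>The image of the boundary of \<open>b\<close>. Both cycle conditions are
      checked below, since in degree 0 exactness is expressed through the augmentation and not
      through \<open>D2\<close>.\<close>
    define w where "w s = (\<Sum>t\<in>B1. D1 t b * \<phi> t s)" for s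
    have lower: "P \<phi> t (\<phi> t)" if "t \<in> B1" "D1 t b \<noteq> 0" for t
      using IH R1.D_hdeg[OF that(1) b that(2)] that(1) by simp
    have "R2.bihomogeneous i (g1 b) w"
      unfolding R2.bihomogeneous_def
    proof (intro ballI conjI impI)
      fix s assume s: "s \<in> B2"
      show "homogeneous (g1 b - g2 s) (w s)" unfolding w_def
      proof (rule homogeneous_sum)
        fix t assume t: "t \<in> B1"
        show "homogeneous (g1 b - g2 s) (D1 t b * \<phi> t s)"
        proof (cases "D1 t b = 0")
          case False
          then have "homogeneous (g1 t - g2 s) (\<phi> t s)"
            using lower[OF t] s unfolding P_def R2.bihomogeneous_def by blast
          from homogeneous_mult[OF R1.D_homogeneous[OF t b] this] show ?thesis by simp
        qed simp
      qed
      assume ne: "h2 s \<noteq> i"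
      show "w s = 0" unfolding w_def
      proof (intro sum.neutral ballI)
        fix t assume t: "t \<in> B1"
        show "D1 t b * \<phi> t s = 0"
        proof (cases "D1 t b = 0")
          case False
          then have "h1 t = i" using R1.D_hdeg[OF t b] Suc by simp
          then show ?thesis
            using lower[OF t False] s ne unfolding P_def R2.bihomogeneous_def by auto
        qed simp
      qed
    qed
    moreover have "(\<Sum>t\<in>B2. D2 s t * w t) = 0" if s: "s \<in> B2" for s
    proof -
      have "(\<Sum>t\<in>B2. D2 s t * w t) = (\<Sum>r\<in>B1. D1 r b * (\<Sum>t\<in>B2. D2 s t * \<phi> r t))"
        unfolding w_def sum_distrib_left by (subst sum.swap) (simp add: ac_simps)
      also have "\<dots> = (\<Sum>r\<in>B1. D1 r b * (\<Sum>t\<in>B1. D1 t r * \<phi> t s))"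
      proof (rule sum.cong[OF refl])
        fix r assume r: "r \<in> B1"
        show "D1 r b * (\<Sum>t\<in>B2. D2 s t * \<phi> r t) = D1 r b * (\<Sum>t\<in>B1. D1 t r * \<phi> t s)"
          using lower[OF r] s unfolding P_def by (cases "D1 r b = 0") auto
      qed
      also have "\<dots> = (\<Sum>t\<in>B1. (\<Sum>r\<in>B1. D1 t r * D1 r b) * \<phi> t s)"
        unfolding sum_distrib_left sum_distrib_right by (subst sum.swap) (simp add: ac_simps)
      also have "\<dots> = 0" using R1.DD_matrix[OF _ b] by simp
      finally show ?thesis .
    qed
    moreover have "(\<Sum>t\<in>B2. a2 t * w t) \<in> I"
    proof -
      have "(\<Sum>t\<in>B2. a2 t * w t) = (\<Sum>r\<in>B1. D1 r b * (\<Sum>t\<in>B2. a2 t * \<phi> r t))"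
        unfolding w_def sum_distrib_left by (subst sum.swap) (simp add: ac_simps)
      also have "\<dots> = (\<Sum>r\<in>B1. D1 r b * ((\<Sum>t\<in>B2. a2 t * \<phi> r t) - a1 r)) + (\<Sum>r\<in>B1. a1 r * D1 r b)"
        by (simp add: right_diff_distrib sum_subtractf ac_simps)
      also have "\<dots> \<in> I"
      proof (rule R1.ideal_add[OF R1.ideal_sum R1.aD_matrix[OF b]])
        fix r assume r: "r \<in> B1"
        show "D1 r b * ((\<Sum>t\<in>B2. a2 t * \<phi> r t) - a1 r) \<in> I"
          using lower[OF r] R1.ideal_0 R1.ideal_mult unfolding P_def by (cases "D1 r b = 0") auto
      qed
      finally show ?thesis .
    qed
    ultimately obtain u where u: "R2.bihomogeneous (Suc i) (g1 b) u" "\<And>s. s \<in> B2 \<Longrightarrow> w s = (\<Sum>t\<in>B2. D2 s t * u t)"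
      using R2.exact_bihomogeneous[of w i "g1 b"] by blast
    have "a2 t * u t = 0" if "t \<in> B2" for t
      using R2.a_hdeg[OF that] u(1) that unfolding R2.bihomogeneous_def by fastforce
    moreover have "a1 b = 0" using R1.a_hdeg[OF b] Suc by auto
    ultimately have "P \<phi> b u"
      using u Suc R1.ideal_0 unfolding P_def w_def by simp
    then show ?thesis by blast
  qed
  have "\<exists>\<phi>. \<forall>b\<in>B1. h1 b < n \<longrightarrow> P \<phi> b (\<phi> b)" for n
  proof (induction n)
    case (Suc n)
    then obtain \<phi> where \<phi>: "\<forall>b\<in>B1. h1 b < n \<longrightarrow> P \<phi> b (\<phi> b)" by blast
    have "\<forall>b\<in>{b \<in> B1. h1 b = n}. \<exists>v. P \<phi> b v" using step \<phi> by simp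
    then obtain \<psi> where \<psi>: "\<forall>b\<in>{b \<in> B1. h1 b = n}. P \<phi> b (\<psi> b)" by (metis (lifting))
    define \<chi> where "\<chi> b = (if h1 b = n then \<psi> b else \<phi> b)" for b
    \<comment> \<open>\<open>P\<close> at \<open>b\<close> sees \<open>\<phi>\<close> only below the
      degree of \<open>b\<close>, because \<open>D1 t b\<close> vanishes otherwise; redefining
      \<open>\<phi>\<close> in degree \<open>n\<close> keeps what was achieved.\<close>
    have same: "P \<chi> b v \<longleftrightarrow> P \<phi> b v" if b: "b \<in> B1" "h1 b \<le> n" for b v
    proof -
      have "D1 t b * \<chi> t s = D1 t b * \<phi> t s" if "t \<in> B1" for t s
        using R1.D_hdeg[OF that b(1)] b(2) by (cases "D1 t b = 0") (auto simp: \<chi>_def)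
      then show ?thesis unfolding P_def by simp
    qed
    have "\<forall>b\<in>B1. h1 b < Suc n \<longrightarrow> P \<chi> b (\<chi> b)"
    proof (intro ballI impI)
      fix b assume b: "b \<in> B1" "h1 b < Suc n"
      show "P \<chi> b (\<chi> b)"
        using same[OF b(1)] b \<phi> \<psi> by (cases "h1 b = n") (auto simp: \<chi>_def)
    qed
    then show ?case by blast
  qed simp
  then obtain \<phi> where \<phi>: "\<forall>b\<in>B1. h1 b < Suc (Max (h1 ` B1)) \<longrightarrow> P \<phi> b (\<phi> b)" by blast
  have "P \<phi> b (\<phi> b)" if "b \<in> B1" for b
    using \<phi> that R1.finite_B by (auto simp: less_Suc_eq_le)
  then show thesis using that[of \<phi>] unfolding P_def by blast
qed

subsection \<open>Cancelling unit entries\<close>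

text \<open>If the entry \<open>D r c\<close> is a unit, then the basis elements \<open>r\<close> and \<open>c\<close> can be cancelled. A vector
  on the remaining basis elements extends uniquely to a vector vanishing at \<open>r\<close> whose boundary also
  vanishes at \<open>r\<close>; this extension is a chain map that is inverse to the restriction up to homotopy.\<close>

lemma (in based_resolution) cancel:
  assumes r: "r \<in> B" and c: "c \<in> B" and unit: "D r c = mterm 0 x" "x \<noteq> 0"
  defines "D' \<equiv> \<lambda>s t. D s t - D s c * mterm 0 (inverse x) * D r t"
  shows "based_resolution I (B - {r, c}) hdeg ideg D' a"
proof -
  define w :: "('v, 'k) mpoly" where "w = mterm 0 (inverse x)"
  define B' where "B' = B - {r, c}"
  define bd where "bd v s = (\<Sum>t\<in>B. D s t * v t)" for v s
  define au where "au v = (\<Sum>t\<in>B. a t * v t)" for v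
  define bd' where "bd' v s = (\<Sum>t\<in>B'. D' s t * v t)" for v s
  define ext where "ext v t = (if t = c then - w * (\<Sum>t\<in>B'. D r t * v t) else if t = r then 0 else v t)" for v t
  have w1: "w * D r c = 1" using unit by (simp add: w_def mult_single)
  have Drc: "D r c \<noteq> 0" using w1 by auto
  have hrc: "hdeg c = Suc (hdeg r)" by (rule D_hdeg[OF r c Drc])
  then have rc: "r \<noteq> c" by auto
  \<comment> \<open>The augmentation does not see the value at \<open>c\<close>, so the correction
    made by \<open>ext\<close> there leaves it unchanged, and \<open>a\<close> itself serves the
    smaller basis.\<close>
  have ac: "a c = 0" using a_hdeg[OF c] hrc by auto
  have irc: "ideg c = ideg r"
    using homogeneous_unit(1)[OF D_homogeneous[OF r c]] unit by simp
  have sumB: "(\<Sum>t\<in>B. f t) = (\<Sum>t\<in>B'. f t) + f r + f c" for f :: "'b \<Rightarrow> ('v, 'k) mpoly"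
  proof -
    have "B = insert r (insert c B')" "r \<notin> insert c B'" "c \<notin> B'" "finite B'"
      using r c rc finite_B by (auto simp: B'_def)
    then show ?thesis by (simp add: ac_simps)
  qed
  have sumB'_ext: "(\<Sum>t\<in>B'. f t * ext v t) = (\<Sum>t\<in>B'. f t * v t)" for f v
    by (rule sum.cong) (auto simp: ext_def B'_def)
  have ext_r: "ext v r = 0" for v using rc by (simp add: ext_def)
  have ext_c: "ext v c = - w * (\<Sum>t\<in>B'. D r t * v t)" for v by (simp add: ext_def)
  have bd_ext: "bd (ext v) s = (\<Sum>t\<in>B'. (D s t - D s c * w * D r t) * v t)" for v s
  proof -
    have "(\<Sum>t\<in>B'. (D s t - D s c * w * D r t) * v t)
        = (\<Sum>t\<in>B'. D s t * v t) - D s c * w * (\<Sum>t\<in>B'. D r t * v t)"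
      by (simp add: left_diff_distrib sum_subtractf sum_distrib_left mult.assoc)
    then show ?thesis unfolding bd_def sumB sumB'_ext ext_r ext_c by (simp add: mult.assoc)
  qed
  have bd_ext_B': "bd (ext v) s = bd' v s" for v s
    unfolding bd_ext bd'_def D'_def w_def by simp
  have bd_ext_r: "bd (ext v) r = 0" for v
  proof -
    have "D r t - D r c * w * D r t = 0" for t using w1 by (simp add: ac_simps)
    then show ?thesis unfolding bd_ext by simp
  qed
  have bdbd: "bd (bd v) s = 0" if "s \<in> B" for v s
    using DD[OF that, of v] unfolding bd_def .
  have ext_unique: "v c = ext v c" if "v r = 0" "bd v r = 0" for v
  proof -
    have "w * ((\<Sum>t\<in>B'. D r t * v t) + D r c * v c) = 0" using that unfolding bd_def sumB by simp
    then have "w * (\<Sum>t\<in>B'. D r t * v t) + (w * D r c) * v c = 0"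
      by (simp only: distrib_left mult.assoc)
    then have "v c + w * (\<Sum>t\<in>B'. D r t * v t) = 0" unfolding w1 by (simp only: mult_1_left add.commute)
    then show ?thesis unfolding ext_c by (simp only: mult_minus_left eq_neg_iff_add_eq_0)
  qed
  have ext_eq: "v t = ext v t" if "v r = 0" "bd v r = 0" for v t
    using ext_unique[OF that] that(1) by (simp add: ext_def)
  have bd_ext_eq: "bd (ext v) t = ext (bd' v) t" for v t
  proof -
    have "bd (ext v) t = ext (bd (ext v)) t" by (rule ext_eq[OF bd_ext_r bdbd[OF r]])
    then show ?thesis unfolding bd_ext_B' .
  qed
  have bd_cong: "bd v s = bd u s" if "\<And>t. v t = u t" for v u s
    unfolding bd_def using that by simp
  have au_ext: "au (ext v) = (\<Sum>t\<in>B'. a t * v t)" for v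
    unfolding au_def sumB sumB'_ext ext_r ac by simp
  have aubd: "au (bd v) \<in> I" for v using aD[of v] unfolding au_def bd_def .
  have bd_col: "bd (\<lambda>t. D t c * y) s = 0" "au (\<lambda>t. D t c * y) \<in> I" if "s \<in> B" for y s
  proof -
    have "bd (\<lambda>t. D t c * y) s = (\<Sum>t\<in>B. D s t * D t c) * y"
      unfolding bd_def by (simp add: sum_distrib_right mult.assoc)
    then show "bd (\<lambda>t. D t c * y) s = 0" using DD_matrix[OF that c] by simp
    have "au (\<lambda>t. D t c * y) = y * (\<Sum>t\<in>B. a t * D t c)"
      unfolding au_def by (simp add: sum_distrib_left ac_simps)
    then show "au (\<lambda>t. D t c * y) \<in> I" using aD_matrix[OF c] by (simp add: ideal_mult)
  qed
  \<comment> \<open>Changing \<open>u\<close> by a multiple of the boundary of \<open>c\<close>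
    clears its value at \<open>r\<close> without changing its boundary, and changes its augmentation
    only within \<open>I\<close>.\<close>
  define red where "red u t = u t - D t c * (w * u r)" for u t
  have red_r: "red u r = 0" for u
  proof -
    have "D r c * (w * u r) = (w * D r c) * u r" by (simp only: ac_simps)
    then show ?thesis unfolding red_def w1 by simp
  qed
  have bd_red: "bd (red u) s = bd u s" if "s \<in> B" for u s
    using bd_col(1)[OF that, of "w * u r"] unfolding bd_def red_def by (simp add: right_diff_distrib sum_subtractf)
  have au_red: "au (red u) - au u \<in> I" for u
  proof -
    have "au (red u) - au u = (-1) * au (\<lambda>t. D t c * (w * u r))"
      unfolding au_def red_def by (simp add: right_diff_distrib sum_subtractf)
    then show ?thesis using ideal_mult[OF bd_col(2)[OF r]] by metis
  qed
  have "based_resolution I B' hdeg ideg D' a"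
  proof unfold_locales
    show "finite B'" using finite_B by (simp add: B'_def)
  next
    fix s t assume st: "s \<in> B'" "t \<in> B'"
    then have stB: "s \<in> B" "t \<in> B" by (auto simp: B'_def)
    show "hdeg t = Suc (hdeg s)" if "D' s t \<noteq> 0"
    proof (cases "D s t = 0")
      case True
      then have "D s c \<noteq> 0" "D r t \<noteq> 0" using that by (auto simp: D'_def)
      then show ?thesis using D_hdeg[OF stB(1) c] D_hdeg[OF r stB(2)] hrc by simp
    qed (use D_hdeg[OF stB] in blast)
    have "homogeneous ((ideg c - ideg s) + 0 + (ideg t - ideg r)) (D s c * w * D r t)"
      using D_homogeneous[OF stB(1) c] D_homogeneous[OF r stB(2)] unfolding w_def
      by (intro homogeneous_mult) simp_all
    then have "homogeneous (ideg t - ideg s) (D s c * w * D r t)" using irc by simp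
    then show "homogeneous (ideg t - ideg s) (D' s t)"
      using D_homogeneous[OF stB] unfolding D'_def w_def by (rule homogeneous_diff[rotated])
  next
    show "hdeg t = 0" if "t \<in> B'" "a t \<noteq> 0" for t using a_hdeg that by (auto simp: B'_def)
    show "homogeneous (ideg t) (a t)" if "t \<in> B'" for t using a_homogeneous that by (auto simp: B'_def)
  next
    fix v
    have "(\<Sum>s\<in>B'. a s * bd' v s) = au (bd (ext v))"
      unfolding au_ext[symmetric] au_def bd_ext_eq ..
    then show "(\<Sum>s\<in>B'. a s * (\<Sum>t\<in>B'. D' s t * v t)) \<in> I"
      using aubd unfolding bd'_def by simp
  next
    fix s v assume "s \<in> B'"
    then have s: "s \<in> B" by (auto simp: B'_def)
    have "bd' (bd' v) s = bd (ext (bd' v)) s" by (rule bd_ext_B'[symmetric])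
    also have "\<dots> = bd (bd (ext v)) s" by (rule bd_cong) (simp only: bd_ext_eq)
    finally show "(\<Sum>r\<in>B'. D' s r * (\<Sum>t\<in>B'. D' r t * v t)) = 0"
      using bdbd[OF s] unfolding bd'_def by simp
  next
    fix v assume cyc: "\<And>s. s \<in> B' \<Longrightarrow> (\<Sum>t\<in>B'. D' s t * v t) = 0" and av: "(\<Sum>t\<in>B'. a t * v t) \<in> I"
    have "ext (bd' v) t = 0" if "t \<in> B" for t
      using cyc that unfolding ext_def bd'_def by (auto simp: B'_def)
    then have "bd (ext v) s = 0" if "s \<in> B" for s using that by (simp add: bd_ext_eq)
    moreover have "au (ext v) \<in> I" using av by (simp add: au_ext)
    ultimately obtain u where u: "\<And>s. s \<in> B \<Longrightarrow> ext v s = bd u s"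
      using exact[of "ext v"] unfolding bd_def au_def by blast
    \<comment> \<open>The boundary of \<open>red u\<close> at \<open>r\<close> is
      \<open>ext v r = 0\<close>, so \<open>red u\<close> is the extension of its own restriction
      and descends to the smaller basis.\<close>
    have "bd (red u) r = 0" using bd_red[OF r] u[OF r] by (simp add: ext_r)
    then have red_ext: "red u t = ext (red u) t" for t by (rule ext_eq[where v = "red u", OF red_r])
    have "v s = bd' (red u) s" if s: "s \<in> B'" for s
    proof -
      have sB: "s \<in> B" using s by (simp add: B'_def)
      have "v s = ext v s" using s by (auto simp: ext_def B'_def)
      also have "\<dots> = bd (red u) s" using u bd_red sB by simp
      also have "\<dots> = bd (ext (red u)) s" by (rule bd_cong[OF red_ext])
      finally show ?thesis unfolding bd_ext_B' .
    qed
    then show "\<exists>u. \<forall>s\<in>B'. v s = (\<Sum>t\<in>B'. D' s t * u t)" unfolding bd'_def by blast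
  next
    obtain v where v: "au v - 1 \<in> I" using onto unfolding au_def by blast
    have "(\<Sum>t\<in>B'. a t * red v t) = au (red v)" unfolding au_def sumB red_r ac by simp
    then have "(\<Sum>t\<in>B'. a t * red v t) - 1 = (au (red v) - au v) + (au v - 1)" by simp
    then show "\<exists>v. (\<Sum>t\<in>B'. a t * v t) - 1 \<in> I" using ideal_add[OF au_red v] by metis
  qed
  then show ?thesis by (simp add: B'_def)
qed

text \<open>A cancellation may create new entries with a constant term, so the induction runs on the
  size of the basis and not on the number of such entries.\<close>

lemma minimal_based_resolution:
  assumes "based_resolution I B hdeg ideg D a"
  obtains B' D' where "based_resolution I B' hdeg ideg D' a" "\<And>s t. s \<in> B' \<Longrightarrow> t \<in> B' \<Longrightarrow> coef (D' s t) 0 = 0"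
proof -
  have "\<exists>B' D'. based_resolution I B' hdeg ideg D' a \<and> (\<forall>s\<in>B'. \<forall>t\<in>B'. coef (D' s t) 0 = 0)"
    using assms
  proof (induction "card B" arbitrary: B D rule: less_induct)
    case less
    interpret based_resolution I B hdeg ideg D a by (rule less.prems)
    show ?case
    proof (cases "\<forall>s\<in>B. \<forall>t\<in>B. coef (D s t) 0 = 0")
      case False
      then obtain r c where rc: "r \<in> B" "c \<in> B" "coef (D r c) 0 \<noteq> 0" by blast
      have "card (B - {r, c}) < card B"
        by (rule psubset_card_mono[OF finite_B]) (use rc in blast)
      then show ?thesis
        by (rule less.hyps[OF _ cancel[OF rc(1,2) homogeneous_unit(2)[OF D_homogeneous[OF rc(1,2)] rc(3)] rc(3)]])
    qed (use less.prems in blast)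
  qed
  then show thesis using that by metis
qed

subsection \<open>Edge ideals\<close>

definition sqfree :: "'v::finite set \<Rightarrow> 'v \<Rightarrow>\<^sub>0 nat" where
  "sqfree A = (\<Sum>v\<in>A. Poly_Mapping.single v 1)"

lemma coef_sqfree [simp]: "coef (sqfree A) v = (if v \<in> A then 1 else 0)"
  by (simp add: sqfree_def lookup_sum lookup_single when_def)

lemma sqfree_le_iff: "(\<forall>v. coef (sqfree A) v \<le> coef m v) \<longleftrightarrow> A \<subseteq> Poly_Mapping.keys m"
  by (auto simp: in_keys_iff Suc_le_eq split: if_splits)

lemma monom_degree_sqfree: "monom_degree (sqfree A) = card A"
  by (simp add: monom_degree_UNIV sum.If_cases)

lemma homogeneous_sqfree: "homogeneous (int (card A)) (mterm (sqfree A) x)"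
  by (simp add: homogeneous_def monom_degree_sqfree)

lemma Var_mult_Var: "x \<noteq> y \<Longrightarrow> Var x * Var y = mterm (sqfree {x, y}) 1"
  by (simp add: Var_def mult_single sqfree_def)

lemma module_times: "Modules.module ((*) :: 'a::comm_ring_1 \<Rightarrow> 'a \<Rightarrow> 'a)"
  by unfold_locales (simp_all add: algebra_simps)

text \<open>Membership in a monomial ideal is decided term by term. In this form closure under
  components is immediate, and exactness of the Taylor complex can be tested one multidegree at a
  time.\<close>

lemma edge_ideal_iff:
  fixes f :: "('v::finite, 'k::field) mpoly"
  assumes "simple_graph E"
  shows "f \<in> edge_ideal E \<longleftrightarrow> (\<forall>m. coef f m \<noteq> 0 \<longrightarrow> (\<exists>e\<in>E. e \<subseteq> Poly_Mapping.keys m))"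
proof
  assume "f \<in> edge_ideal E"
  then show "\<forall>m. coef f m \<noteq> 0 \<longrightarrow> (\<exists>e\<in>E. e \<subseteq> Poly_Mapping.keys m)"
    unfolding edge_ideal_def ideal_generated_def
  proof (induction rule: Modules.module.span_induct_alt[OF module_times, consumes 1, case_names base step])
    case (step c x y)
    from step.hyps(1) obtain u v where e: "{u, v} \<in> E" and x: "x = Var u * Var v" by blast
    have uv: "u \<noteq> v" using e assms unfolding simple_graph_def by force
    have "{u, v} \<subseteq> Poly_Mapping.keys m" if "coef (c * x) m \<noteq> 0" for m
      using that unfolding x Var_mult_Var[OF uv] mult.commute[of c] coef_mterm_mult sqfree_le_iff
      by (metis (no_types))
    then show ?case using step.IH e by (metis (no_types) lookup_add add.right_neutral)
  qed simp
next
  assume f: "\<forall>m. coef f m \<noteq> 0 \<longrightarrow> (\<exists>e\<in>E. e \<subseteq> Poly_Mapping.keys m)"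
  have "mterm m (coef f m) \<in> edge_ideal E" if m: "m \<in> Poly_Mapping.keys f" for m
  proof -
    obtain e where e: "e \<in> E" "e \<subseteq> Poly_Mapping.keys m" using f m by (auto simp: in_keys_iff)
    obtain x y where xy: "e = {x, y}" "x \<noteq> y"
      using assms e(1) unfolding simple_graph_def by (metis card_2_iff)
    have "m = (m - sqfree e) + sqfree e"
      using e(2)[folded sqfree_le_iff] by (auto simp: poly_mapping_eq_iff fun_eq_iff lookup_add lookup_minus simp del: coef_sqfree)
    then have eq: "mterm m (coef f m) = mterm (m - sqfree e) (coef f m) * (Var x * Var y)"
      unfolding Var_mult_Var[OF xy(2)] xy(1)[symmetric] by (metis mult_single mult.right_neutral)
    show ?thesis
      unfolding edge_ideal_def ideal_generated_def eq
      by (intro Modules.module.span_scale[OF module_times] Modules.module.span_base[OF module_times])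
        (use e(1) xy(1) in blast)
  qed
  then have "(\<Sum>m\<in>Poly_Mapping.keys f. mterm m (coef f m)) \<in> edge_ideal E"
    unfolding edge_ideal_def ideal_generated_def by (rule Modules.module.span_sum[OF module_times])
  then show "f \<in> edge_ideal E" using poly_expand[of f] by simp
qed

lemma homogeneous_edge_ideal:
  assumes E: "simple_graph E"
  shows "homogeneous_ideal (edge_ideal E :: ('v::finite, 'k::field) mpoly set)"
proof unfold_locales
  show "f + g \<in> edge_ideal E" if "f \<in> edge_ideal E" "g \<in> edge_ideal E" for f g :: "('v, 'k) mpoly"
    using that unfolding edge_ideal_def ideal_generated_def by (rule Modules.module.span_add[OF module_times])
  show "f * g \<in> edge_ideal E" if "g \<in> edge_ideal E" for f g :: "('v, 'k) mpoly"
    using that unfolding edge_ideal_def ideal_generated_def by (rule Modules.module.span_scale[OF module_times])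
qed (simp_all add: edge_ideal_iff[OF E] coef_hcomp)

text \<open>Polynomials congruent modulo the ideal thus share their constant term, which starts the
  induction on the diagonal entries.\<close>

lemma edge_ideal_coef_0:
  fixes f :: "('v::finite, 'k::field) mpoly"
  assumes "simple_graph E" "f \<in> edge_ideal E"
  shows "coef f 0 = 0"
proof (rule ccontr)
  assume "coef f 0 \<noteq> 0"
  then obtain e where "e \<in> E" "e \<subseteq> Poly_Mapping.keys (0 :: 'v \<Rightarrow>\<^sub>0 nat)"
    using assms edge_ideal_iff by blast
  then show False using assms(1) by (auto simp: simple_graph_def)
qed

subsection \<open>The Taylor resolution\<close>

text \<open>The usual orientation sign on the simplex of edges, numbered by \<open>idx\<close>.
  Counting only elements strictly before \<open>k\<close> makes it independent of whether
  \<open>k\<close> belongs to \<open>A\<close>.\<close>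

definition esign :: "('e \<Rightarrow> nat) \<Rightarrow> 'e \<Rightarrow> 'e set \<Rightarrow> 'k::comm_ring_1" where
  "esign idx k A = (- 1) ^ card {j \<in> A. idx j < idx k}"

lemma esign_insert:
  assumes "finite A" "l \<notin> A"
  shows "esign idx k (insert l A) = (if idx l < idx k then - esign idx k A else esign idx k A)"
proof -
  have "{j \<in> insert l A. idx j < idx k} = (if idx l < idx k then insert l {j \<in> A. idx j < idx k} else {j \<in> A. idx j < idx k})"
    by auto
  then show ?thesis using assms by (simp add: esign_def)
qed

lemma esign_insert_self [simp]: "esign idx k (insert k A) = esign idx k A"
  unfolding esign_def by (intro arg_cong[where f = "\<lambda>X. (- 1) ^ card X"]) auto

lemma esign_square [simp]: "esign idx k A * esign idx k A = 1" "esign idx k A * (esign idx k A * x) = x"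
  by (simp_all add: esign_def flip: mult.assoc power_mult_distrib)

text \<open>Exactly one of \<open>k\<close>, \<open>l\<close> precedes the other, so exactly one of
  the two insertions changes a sign. The first identity serves the cone homotopy, the second
  \<open>\<partial>\<partial> = 0\<close>.\<close>

lemma esign_swap:
  assumes "finite A" "k \<notin> A" "l \<notin> A" "idx k \<noteq> idx l"
  shows "esign idx k (insert l A) * esign idx l (insert k A) = - (esign idx k A * esign idx l A)"
    "esign idx k A * esign idx l (insert k A) = - (esign idx l A * esign idx k (insert l A))"
  using assms by (auto simp: esign_insert)

text \<open>Antisymmetry alone shows only that twice the sum vanishes, which says nothing in
  characteristic 2. Ordering the pairs by \<open>idx\<close> and matching each with its reversal
  cancels them outright.\<close>

lemma sum_antisymmetric_pairs:
  fixes g :: "'e \<Rightarrow> 'e \<Rightarrow> 'a::ab_group_add" and idx :: "'e \<Rightarrow> nat"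
  assumes S: "finite S" "inj_on idx S"
    and anti: "\<And>k l. k \<in> S \<Longrightarrow> l \<in> S \<Longrightarrow> k \<noteq> l \<Longrightarrow> g k l = - g l k"
  shows "(\<Sum>k\<in>S. \<Sum>l\<in>S - {k}. g k l) = 0"
proof -
  have "(\<Sum>k\<in>S. \<Sum>l\<in>S - {k}. g k l)
      = (\<Sum>k\<in>S. (\<Sum>l\<in>{l \<in> S. idx l < idx k}. g k l) + (\<Sum>l\<in>{l \<in> S. idx k < idx l}. g k l))"
  proof (rule sum.cong[OF refl])
    fix k assume k: "k \<in> S"
    have "S - {k} = {l \<in> S. idx l < idx k} \<union> {l \<in> S. idx k < idx l}"
      using inj_on_eq_iff[OF S(2) k] by auto (metis linorder_neqE_nat)
    then show "(\<Sum>l\<in>S - {k}. g k l) = (\<Sum>l\<in>{l \<in> S. idx l < idx k}. g k l) + (\<Sum>l\<in>{l \<in> S. idx k < idx l}. g k l)"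
      using S(1) by (simp add: sum.union_disjoint disjoint_iff)
  qed
  also have "\<dots> = (\<Sum>k\<in>S. \<Sum>l\<in>{l \<in> S. idx l < idx k}. g k l) + (\<Sum>k\<in>S. \<Sum>l\<in>{l \<in> S. idx k < idx l}. g k l)"
    by (rule sum.distrib)
  also have "(\<Sum>k\<in>S. \<Sum>l\<in>{l \<in> S. idx k < idx l}. g k l) = (\<Sum>l\<in>S. \<Sum>k\<in>{k \<in> S. idx k < idx l}. g k l)"
    by (rule sum.swap_restrict) (rule S(1))+
  also have "\<dots> = (\<Sum>l\<in>S. \<Sum>k\<in>{k \<in> S. idx k < idx l}. - g l k)"
    by (intro sum.cong refl anti) auto
  finally show ?thesis by (simp add: sum_negf)
qed

text \<open>The monomial on \<open>k - \<Union>s\<close> is the quotient of the least common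
  multiples of the edge monomials in \<open>t\<close> and in \<open>s\<close>. The sum only selects
  \<open>k\<close>: at most one of its terms is nonzero.\<close>

definition taylor_bd :: "('v::finite set \<Rightarrow> nat) \<Rightarrow> 'v set set \<Rightarrow> 'v set set \<Rightarrow> ('v, 'k::field) mpoly" where
  "taylor_bd idx s t = (\<Sum>k\<in>t. if s = t - {k} then mterm (sqfree (k - \<Union>s)) (esign idx k s) else 0)"

definition taylor_aug :: "'v set set \<Rightarrow> ('v, 'k::field) mpoly" where
  "taylor_aug t = (if t = {} then 1 else 0)"

lemma sum_taylor_aug:
  fixes f :: "'v::finite set set \<Rightarrow> ('v, 'k::field) mpoly"
  shows "(\<Sum>s\<in>Pow E. taylor_aug s * f s) = f {}"
proof -
  have "(\<Sum>s\<in>Pow E. taylor_aug s * f s) = (\<Sum>s\<in>Pow E. if s = {} then f s else 0)"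
    by (rule sum.cong) (auto simp: taylor_aug_def)
  then show ?thesis by simp
qed

lemma taylor_bd_eq: "k \<in> t \<Longrightarrow> taylor_bd idx (t - {k}) t = mterm (sqfree (k - \<Union>(t - {k}))) (esign idx k (t - {k}))"
proof -
  assume k: "k \<in> t"
  have "taylor_bd idx (t - {k}) t = (\<Sum>l\<in>t. if l = k then mterm (sqfree (k - \<Union>(t - {k}))) (esign idx k (t - {k})) else 0)"
    unfolding taylor_bd_def using k by (intro sum.cong) auto
  then show ?thesis using k by simp
qed

lemma taylor_bd_nonzero:
  assumes "taylor_bd idx s t \<noteq> 0"
  obtains k where "k \<in> t" "s = t - {k}"
proof -
  have "\<exists>k\<in>t. s = t - {k}"
  proof (rule ccontr)
    assume "\<not> (\<exists>k\<in>t. s = t - {k})"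
    then show False using assms by (simp add: taylor_bd_def)
  qed
  then show thesis using that by blast
qed

lemma taylor_row:
  fixes v :: "'v::finite set set \<Rightarrow> ('v, 'k::field) mpoly"
  assumes s: "s \<subseteq> E"
  shows "(\<Sum>t\<in>Pow E. taylor_bd idx s t * v t)
    = (\<Sum>k\<in>E - s. mterm (sqfree (k - \<Union>s)) (esign idx k s) * v (insert k s))"
proof -
  have "(\<Sum>t\<in>Pow E. taylor_bd idx s t * v t)
      = (\<Sum>t\<in>Pow E. \<Sum>k\<in>E. if k \<in> t \<and> s = t - {k} then mterm (sqfree (k - \<Union>s)) (esign idx k s) * v t else 0)"
  proof (rule sum.cong[OF refl])
    fix t assume t: "t \<in> Pow E"
    have "taylor_bd idx s t * v t
        = (\<Sum>k\<in>t. if s = t - {k} then mterm (sqfree (k - \<Union>s)) (esign idx k s) * v t else 0)"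
      unfolding taylor_bd_def sum_distrib_right by (rule sum.cong) auto
    also have "\<dots> = (\<Sum>k\<in>E. if k \<in> t \<and> s = t - {k} then mterm (sqfree (k - \<Union>s)) (esign idx k s) * v t else 0)"
      using t by (intro sum.mono_neutral_cong_left) auto
    finally show "taylor_bd idx s t * v t = \<dots>" .
  qed
  also have "\<dots> = (\<Sum>k\<in>E. \<Sum>t\<in>Pow E. if k \<in> t \<and> s = t - {k} then mterm (sqfree (k - \<Union>s)) (esign idx k s) * v t else 0)"
    by (rule sum.swap)
  also have "\<dots> = (\<Sum>k\<in>E. if k \<in> s then 0 else mterm (sqfree (k - \<Union>s)) (esign idx k s) * v (insert k s))"
  proof (rule sum.cong[OF refl])
    fix k assume k: "k \<in> E"
    have "(k \<in> t \<and> s = t - {k}) \<longleftrightarrow> k \<notin> s \<and> t = insert k s" for t by auto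
    then show "(\<Sum>t\<in>Pow E. if k \<in> t \<and> s = t - {k} then mterm (sqfree (k - \<Union>s)) (esign idx k s) * v t else 0)
        = (if k \<in> s then 0 else mterm (sqfree (k - \<Union>s)) (esign idx k s) * v (insert k s))"
      using k s by simp
  qed
  also have "\<dots> = (\<Sum>k\<in>E - s. mterm (sqfree (k - \<Union>s)) (esign idx k s) * v (insert k s))"
    by (intro sum.mono_neutral_cong_right) auto
  finally show ?thesis .
qed

text \<open>The strand of a vector in multidegree \<open>M\<close>, as a simplicial chain on the simplex whose vertices
  are the edges dividing \<open>M\<close>.\<close>

definition strand :: "('v::finite set set \<Rightarrow> ('v, 'k::field) mpoly) \<Rightarrow> ('v \<Rightarrow>\<^sub>0 nat) \<Rightarrow> 'v set set \<Rightarrow> 'k" where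
  "strand v M A = (if \<Union>A \<subseteq> Poly_Mapping.keys M then coef (v A) (M - sqfree (\<Union>A)) else 0)"

text \<open>In a fixed multidegree each monomial factor just accounts for the difference of the
  shifts, so only signs are left and the boundary becomes that of a simplex.\<close>

lemma coef_taylor_row:
  fixes v :: "'v::finite set set \<Rightarrow> ('v, 'k::field) mpoly"
  assumes s: "s \<subseteq> E" "\<Union>s \<subseteq> Poly_Mapping.keys M"
  shows "coef (\<Sum>t\<in>Pow E. taylor_bd idx s t * v t) (M - sqfree (\<Union>s))
    = (\<Sum>k\<in>E - s. esign idx k s * strand v M (insert k s))"
  unfolding taylor_row[OF s(1)] lookup_sum
proof (rule sum.cong[OF refl])
  fix k assume "k \<in> E - s"
  have "(\<forall>v. coef (sqfree (k - \<Union>s)) v \<le> coef (M - sqfree (\<Union>s)) v) \<longleftrightarrow> \<Union>(insert k s) \<subseteq> Poly_Mapping.keys M"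
  proof -
    have "k - \<Union>s \<subseteq> Poly_Mapping.keys (M - sqfree (\<Union>s)) \<longleftrightarrow> k - \<Union>s \<subseteq> Poly_Mapping.keys M"
      by (auto simp: in_keys_iff lookup_minus)
    then show ?thesis unfolding sqfree_le_iff using s(2) by (simp add: Diff_subset_conv Un_absorb1)
  qed
  moreover have "M - sqfree (\<Union>s) - sqfree (k - \<Union>s) = M - sqfree (\<Union>(insert k s))"
    by (rule poly_mapping_eqI) (auto simp: lookup_minus)
  ultimately show "coef (mterm (sqfree (k - \<Union>s)) (esign idx k s) * v (insert k s)) (M - sqfree (\<Union>s))
      = esign idx k s * strand v M (insert k s)"
    unfolding coef_mterm_mult strand_def by simp
qed

text \<open>In a multidegree divisible by some edge the strand lives on a full simplex, whose
  augmented chain complex is exact. In any other multidegree only the empty face is left, and there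
  the assumption on \<open>v {}\<close> makes the coefficient vanish.\<close>

lemma taylor_exact:
  fixes v :: "'v::finite set set \<Rightarrow> ('v, 'k::field) mpoly"
  assumes E: "simple_graph E" "inj_on idx E"
    and cycle: "\<And>s. s \<subseteq> E \<Longrightarrow> (\<Sum>t\<in>Pow E. taylor_bd idx s t * v t) = 0" and v0: "v {} \<in> edge_ideal E"
  shows "\<exists>u. \<forall>s\<in>Pow E. v s = (\<Sum>t\<in>Pow E. taylor_bd idx s t * u t)"
proof -
  \<comment> \<open>In each multidegree \<open>M\<close>, cone off the simplex with an edge dividing \<open>M\<close>.\<close>
  define apex where "apex M = (SOME e. e \<in> E \<and> e \<subseteq> Poly_Mapping.keys M)" for M :: "'v \<Rightarrow>\<^sub>0 nat"
  define h where "h A m = (let M = m + sqfree (\<Union>A); k = apex M in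
      if k \<in> A then esign idx k (A - {k}) * strand v M (A - {k}) else 0)" for A m
  define u where "u A = Abs_poly_mapping (h A)" for A
  have "finite {m. h A m \<noteq> 0}" for A
  proof (rule finite_subset)
    show "{m. h A m \<noteq> 0} \<subseteq> (\<Union>k\<in>A. (\<lambda>m. m + (sqfree (\<Union>A) - sqfree (\<Union>(A - {k})))) -` Poly_Mapping.keys (v (A - {k})))"
    proof
      fix m assume "m \<in> {m. h A m \<noteq> 0}"
      then obtain k where k: "k \<in> A" "coef (v (A - {k})) (m + sqfree (\<Union>A) - sqfree (\<Union>(A - {k}))) \<noteq> 0"
        unfolding h_def strand_def Let_def by (auto split: if_splits)
      have "m + sqfree (\<Union>A) - sqfree (\<Union>(A - {k})) = m + (sqfree (\<Union>A) - sqfree (\<Union>(A - {k})))"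
        by (rule poly_mapping_eqI) (auto simp: lookup_minus lookup_add)
      then show "m \<in> (\<Union>k\<in>A. (\<lambda>m. m + (sqfree (\<Union>A) - sqfree (\<Union>(A - {k})))) -` Poly_Mapping.keys (v (A - {k})))"
        using k by (auto simp: in_keys_iff)
    qed
    show "finite (\<Union>k\<in>A. (\<lambda>m. m + (sqfree (\<Union>A) - sqfree (\<Union>(A - {k})))) -` Poly_Mapping.keys (v (A - {k})))"
      by (intro finite_UN_I finite_vimageI) (auto intro: injI)
  qed
  then have coef_u: "coef (u A) = h A" for A unfolding u_def by simp
  have "v s = (\<Sum>t\<in>Pow E. taylor_bd idx s t * u t)" if s: "s \<subseteq> E" for s
  proof (rule poly_mapping_eqI)
    fix m
    define M where "M = m + sqfree (\<Union>s)"
    have sM: "\<Union>s \<subseteq> Poly_Mapping.keys M" by (auto simp: M_def in_keys_iff lookup_add)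
    have m: "m = M - sqfree (\<Union>s)" by (rule poly_mapping_eqI) (simp add: M_def lookup_add lookup_minus)
    have vs: "coef (v s) m = strand v M s" using sM by (simp add: strand_def m)
    have str_u: "strand u M A = (if \<Union>A \<subseteq> Poly_Mapping.keys M \<and> apex M \<in> A
        then esign idx (apex M) (A - {apex M}) * strand v M (A - {apex M}) else 0)" for A
    proof (cases "\<Union>A \<subseteq> Poly_Mapping.keys M")
      case True
      then have "M - sqfree (\<Union>A) + sqfree (\<Union>A) = M"
        using True[folded sqfree_le_iff]
        by (auto simp: poly_mapping_eq_iff fun_eq_iff lookup_add lookup_minus simp del: coef_sqfree)
      then show ?thesis using True by (simp add: strand_def[of u] coef_u h_def Let_def)
    qed (simp add: strand_def)
    have rhs: "coef (\<Sum>t\<in>Pow E. taylor_bd idx s t * u t) m = (\<Sum>k\<in>E - s. esign idx k s * strand u M (insert k s))"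
      unfolding m by (rule coef_taylor_row[OF s sM])
    show "coef (v s) m = coef (\<Sum>t\<in>Pow E. taylor_bd idx s t * u t) m"
    proof (cases "\<exists>e\<in>E. e \<subseteq> Poly_Mapping.keys M")
      case False
      then have "s = {}" using s sM by blast
      moreover have "M = m" using \<open>s = {}\<close> by (simp add: M_def sqfree_def)
      ultimately have "coef (v s) m = 0" using v0 False unfolding edge_ideal_iff[OF E(1)] by auto
      moreover have "strand u M (insert k s) = 0" if "k \<in> E - s" for k
        using that False unfolding str_u by auto
      ultimately show ?thesis unfolding rhs by simp
    next
      case True
      define a where "a = apex M"
      have a: "a \<in> E" "a \<subseteq> Poly_Mapping.keys M"
        using someI_ex[of "\<lambda>e. e \<in> E \<and> e \<subseteq> Poly_Mapping.keys M"] True unfolding a_def apex_def by blast+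
      show ?thesis
      proof (cases "a \<in> s")
        case False
        \<comment> \<open>If \<open>s\<close> lacks the apex, only \<open>insert a s\<close> among
          its cofaces contains it, and the sign then occurs twice.\<close>
        have "(\<Sum>k\<in>E - s. esign idx k s * strand u M (insert k s)) = (\<Sum>k\<in>E - s. if k = a then strand v M s else 0)"
        proof (rule sum.cong[OF refl])
          fix k assume "k \<in> E - s"
          then show "esign idx k s * strand u M (insert k s) = (if k = a then strand v M s else 0)"
            using False a sM unfolding str_u a_def[symmetric] by auto
        qed
        then show ?thesis unfolding rhs vs using a(1) False by simp
      next
        case True
        define A where "A = s - {a}"
        have sA: "s = insert a A" "a \<notin> A" using True by (auto simp: A_def)
        have AE: "A \<subseteq> E" "\<Union>A \<subseteq> Poly_Mapping.keys M" using s sM by (auto simp: A_def)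
        \<comment> \<open>The cycle condition at the face \<open>A\<close> opposite the apex
          expresses the coefficient at \<open>s\<close> through the faces \<open>insert k A\<close>,
          from which \<open>u\<close> takes its values at \<open>insert k s\<close>.\<close>
        have "0 = (\<Sum>k\<in>E - A. esign idx k A * strand v M (insert k A))"
          using coef_taylor_row[OF AE, of idx v] cycle[OF AE(1)] by simp
        also have "E - A = insert a (E - s)" using a(1) by (auto simp: A_def)
        finally have 0: "0 = esign idx a A * strand v M s + (\<Sum>k\<in>E - s. esign idx k A * strand v M (insert k A))"
          using True sA by simp
        have "(\<Sum>k\<in>E - s. esign idx k s * strand u M (insert k s))
            = (\<Sum>k\<in>E - s. - esign idx a A * (esign idx k A * strand v M (insert k A)))"
        proof (rule sum.cong[OF refl])
          fix k assume k: "k \<in> E - s"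
          have ne: "idx k \<noteq> idx a" "k \<noteq> a" "k \<notin> A" using k a(1) True E(2) by (auto dest: inj_onD simp: A_def)
          have ins: "insert k s - {a} = insert k A" using ne sA by auto
          show "esign idx k s * strand u M (insert k s) = - esign idx a A * (esign idx k A * strand v M (insert k A))"
          proof (cases "k \<subseteq> Poly_Mapping.keys M")
            case in_M: True
            then have "strand u M (insert k s) = esign idx a (insert k A) * strand v M (insert k A)"
              unfolding str_u a_def[symmetric] ins using sM True by simp
            then have "esign idx k s * strand u M (insert k s)
                = (esign idx k (insert a A) * esign idx a (insert k A)) * strand v M (insert k A)"
              unfolding sA(1) by (simp only: mult.assoc)
            also have "\<dots> = - (esign idx k A * esign idx a A) * strand v M (insert k A)"
              unfolding esign_swap(1)[OF finite ne(3) sA(2) ne(1)] by (rule refl)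
            finally show ?thesis by (simp add: ac_simps)
          next
            case False
            then show ?thesis unfolding str_u by (simp add: strand_def)
          qed
        qed
        also have "\<dots> = - esign idx a A * (\<Sum>k\<in>E - s. esign idx k A * strand v M (insert k A))"
          by (simp only: sum_distrib_left)
        also have "(\<Sum>k\<in>E - s. esign idx k A * strand v M (insert k A)) = - (esign idx a A * strand v M s)"
          using 0 by (simp add: eq_neg_iff_add_eq_0 add.commute)
        finally show ?thesis unfolding rhs vs by simp
      qed
    qed
  qed
  then show ?thesis by blast
qed

lemma taylor_resolution:
  fixes E :: "'v::finite set set"
  assumes E: "simple_graph E" "inj_on idx E"
  shows "based_resolution (edge_ideal E :: ('v, 'k::field) mpoly set) (Pow E) card (\<lambda>A. int (card (\<Union>A)))
    (taylor_bd idx) taylor_aug"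
proof -
  interpret homogeneous_ideal "edge_ideal E :: ('v, 'k) mpoly set" by (rule homogeneous_edge_ideal[OF E(1)])
  show ?thesis
  proof unfold_locales
    show "finite (Pow E)" by simp
  next
    fix s t assume st: "s \<in> Pow E" "t \<in> Pow E"
    show "card t = Suc (card s)" if "taylor_bd idx s t \<noteq> (0 :: ('v, 'k) mpoly)"
      using that by (rule taylor_bd_nonzero) (simp add: card_Suc_Diff1 del: card_Diff_insert)
    show "homogeneous (int (card (\<Union>t)) - int (card (\<Union>s))) (taylor_bd idx s t :: ('v, 'k) mpoly)"
    proof (cases "taylor_bd idx s t = (0 :: ('v, 'k) mpoly)")
      case False
      then obtain k where k: "k \<in> t" "s = t - {k}" by (rule taylor_bd_nonzero)
      have "\<Union>t = \<Union>s \<union> (k - \<Union>s)" using k by auto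
      moreover have "card (\<Union>s \<union> (k - \<Union>s)) = card (\<Union>s) + card (k - \<Union>s)" by (rule card_Un_disjoint) auto
      ultimately have "int (card (\<Union>t)) - int (card (\<Union>s)) = int (card (k - \<Union>s))" by simp
      then show ?thesis unfolding k(2) taylor_bd_eq[OF k(1)] by (simp only: homogeneous_sqfree)
    qed simp
  next
    show "card t = 0" if "taylor_aug t \<noteq> (0 :: ('v, 'k) mpoly)" for t :: "'v set set"
      using that by (auto simp: taylor_aug_def split: if_splits)
    show "homogeneous (int (card (\<Union>t))) (taylor_aug t :: ('v, 'k) mpoly)" for t :: "'v set set"
      by (simp add: taylor_aug_def homogeneous_def monom_degree_def)
  next
    fix v :: "'v set set \<Rightarrow> ('v, 'k) mpoly"
    have "mterm (sqfree (k - {})) x * y \<in> edge_ideal E" if "k \<in> E" for k x and y :: "('v, 'k) mpoly"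
      using that unfolding mult.commute[of _ y]
      by (intro ideal_mult) (auto simp: edge_ideal_iff[OF E(1)] lookup_single when_def in_keys_iff)
    then show "(\<Sum>s\<in>Pow E. taylor_aug s * (\<Sum>t\<in>Pow E. taylor_bd idx s t * v t)) \<in> edge_ideal E"
      unfolding sum_taylor_aug taylor_row[OF empty_subsetI] Union_empty by (intro ideal_sum) simp
  next
    fix s and v :: "'v set set \<Rightarrow> ('v, 'k) mpoly" assume "s \<in> Pow E"
    then have s: "s \<subseteq> E" by simp
    \<comment> \<open>Monomial and basis element are symmetric in \<open>k\<close> and
      \<open>l\<close>, so the sign alone decides the cancellation.\<close>
    define g where "g k l = mterm (sqfree (k \<union> l - \<Union>s)) (esign idx k s * esign idx l (insert k s)) * v (insert l (insert k s))" for k l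
    have "(\<Sum>r\<in>Pow E. taylor_bd idx s r * (\<Sum>t\<in>Pow E. taylor_bd idx r t * v t)) = (\<Sum>k\<in>E - s. \<Sum>l\<in>E - s - {k}. g k l)"
      unfolding taylor_row[OF s]
    proof (rule sum.cong[OF refl])
      fix k assume k: "k \<in> E - s"
      then have ks: "insert k s \<subseteq> E" using s by auto
      have "E - insert k s = E - s - {k}" by auto
      moreover have "mterm (sqfree (k - \<Union>s)) (esign idx k s) *
          (mterm (sqfree (l - \<Union>(insert k s))) (esign idx l (insert k s)) * v (insert l (insert k s))) = g k l" for l
      proof -
        have "sqfree (k - \<Union>s) + sqfree (l - \<Union>(insert k s)) = sqfree (k \<union> l - \<Union>s)"
          by (rule poly_mapping_eqI) (auto simp: lookup_add)
        then show ?thesis unfolding g_def by (simp add: mult_single flip: mult.assoc)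
      qed
      ultimately show "mterm (sqfree (k - \<Union>s)) (esign idx k s) * (\<Sum>t\<in>Pow E. taylor_bd idx (insert k s) t * v t)
          = (\<Sum>l\<in>E - s - {k}. g k l)"
        unfolding taylor_row[OF ks] sum_distrib_left by simp
    qed
    also have "\<dots> = 0"
    proof (rule sum_antisymmetric_pairs)
      show "finite (E - s)" by simp
      show "inj_on idx (E - s)" using E(2) by (rule inj_on_subset) auto
      fix k l assume kl: "k \<in> E - s" "l \<in> E - s" "k \<noteq> l"
      then have "idx k \<noteq> idx l" using E(2) by (auto dest: inj_onD)
      then have "esign idx k s * esign idx l (insert k s) = - (esign idx l s * esign idx k (insert l s) :: 'k)"
        using esign_swap(2)[of s k l idx] kl by auto
      then show "g k l = - g l k"
        unfolding g_def by (simp add: Un_commute insert_commute single_uminus)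
    qed
    finally show "(\<Sum>r\<in>Pow E. taylor_bd idx s r * (\<Sum>t\<in>Pow E. taylor_bd idx r t * v t)) = 0" .
  next
    fix v :: "'v set set \<Rightarrow> ('v, 'k) mpoly"
    assume "\<And>s. s \<in> Pow E \<Longrightarrow> (\<Sum>t\<in>Pow E. taylor_bd idx s t * v t) = 0"
      "(\<Sum>t\<in>Pow E. taylor_aug t * v t) \<in> edge_ideal E"
    then show "\<exists>u. \<forall>s\<in>Pow E. v s = (\<Sum>t\<in>Pow E. taylor_bd idx s t * u t)"
      unfolding sum_taylor_aug by (intro taylor_exact[OF E]) auto
  next
    show "\<exists>v. (\<Sum>t\<in>Pow E. taylor_aug t * v t) - 1 \<in> (edge_ideal E :: ('v, 'k) mpoly set)"
      unfolding sum_taylor_aug using ideal_0 by (intro exI[of _ "\<lambda>_. 1"]) simp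
  qed
qed

subsection \<open>Induced matchings and Betti numbers\<close>

lemma card_Union_matching:
  assumes "simple_graph E" "induced_matching E M" "finite M"
  shows "card (\<Union>M) = 2 * card M"
proof -
  have c2: "card e = 2" if "e \<in> M" for e
    using assms(1,2) that unfolding simple_graph_def induced_matching_def by blast
  have "card (\<Union>M) = (\<Sum>e\<in>M. card e)"
    using assms(2) c2 unfolding induced_matching_def
    by (intro card_Union_disjoint) (auto simp: pairwise_def disjnt_def intro: card_ge_0_finite)
  then show ?thesis using c2 by simp
qed

text \<open>For a chain endomorphism \<open>\<theta>\<close> of the Taylor resolution lifting the identity, comparing
  coefficients of the monomial \<open>l\<close> at the basis element \<open>A - {l}\<close> in \<open>\<partial>\<theta> = \<theta>\<partial>\<close> shows that the
  constant terms of the diagonal entries at \<open>A\<close> and at \<open>A - {l}\<close> agree: by inducedness no other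
  entry contributes.\<close>

lemma taylor_endomorphism_diagonal:
  fixes \<theta> :: "'v::finite set set \<Rightarrow> 'v set set \<Rightarrow> ('v, 'k::field) mpoly"
  assumes E: "simple_graph E" and M: "induced_matching E M"
    and chain: "\<And>A s. A \<subseteq> E \<Longrightarrow> s \<subseteq> E \<Longrightarrow>
      (\<Sum>t\<in>Pow E. taylor_bd idx s t * \<theta> A t) = (\<Sum>t\<in>Pow E. taylor_bd idx t A * \<theta> t s)"
    and \<theta>0: "\<theta> {} {} - 1 \<in> edge_ideal E"
  shows "A \<subseteq> M \<Longrightarrow> coef (\<theta> A A) 0 = 1"
proof (induction A rule: finite_induct[OF finite])
  case 1
  have "coef (\<theta> {} {} - 1) 0 = 0" by (rule edge_ideal_coef_0[OF E \<theta>0])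
  then show ?case by (simp add: lookup_minus)
next
  case (2 l B)
  define A where "A = insert l B"
  have disj: "e \<inter> f = {}" if "e \<in> M" "f \<in> M" "e \<noteq> f" for e f
    using M that unfolding induced_matching_def by blast+
  have induced: "f \<in> M" if "f \<in> E" "f \<subseteq> \<Union>M" for f
    using M that unfolding induced_matching_def by blast
  have ME: "M \<subseteq> E" using M unfolding induced_matching_def by blast
  have ne: "e \<noteq> {}" if "e \<in> E" for e using E that by (auto simp: simple_graph_def)
  have AM: "A \<subseteq> M" "A \<subseteq> E" "B \<subseteq> E" "l \<in> M" using "2.prems" ME by (auto simp: A_def)
  have sub: "k = l" if "k \<in> M" "k \<subseteq> l" for k
    using disj[OF that(1) AM(4)] that ne[of k] ME by auto
  have dl: "l - \<Union>B = l" using disj[OF AM(4)] "2.hyps" AM by (fastforce simp: A_def)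
  have keys_l: "Poly_Mapping.keys (sqfree l) = l" by (auto simp: in_keys_iff split: if_splits)
  \<comment> \<open>A monomial factor reaches \<open>sqfree l\<close> only if its support lies in
    \<open>l\<close>; with proper subsets excluded, only the constant term of the other factor
    matters.\<close>
  have coef_l: "coef (mterm (sqfree X) x * f) (sqfree l) = (if X = l then x * coef f 0 else 0)"
    if "\<not> X \<subset> l" for X and x :: 'k and f
    unfolding coef_mterm_mult sqfree_le_iff keys_l using that by auto
  have "coef (\<Sum>t\<in>Pow E. taylor_bd idx B t * \<theta> A t) (sqfree l) = (\<Sum>k\<in>E - B. if k = l then esign idx l B * coef (\<theta> A A) 0 else 0)"
    unfolding taylor_row[OF AM(3)] lookup_sum
  proof (rule sum.cong[OF refl])
    fix k assume k: "k \<in> E - B"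
    \<comment> \<open>Otherwise \<open>k\<close> lies in \<open>\<Union>A\<close>, so inducedness
      puts it into \<open>M\<close>; being none of the members of \<open>A\<close>, it is disjoint
      from all of them and hence empty.\<close>
    have not_l: "\<not> k - \<Union>B \<subseteq> l" if "k \<noteq> l"
    proof
      assume "k - \<Union>B \<subseteq> l"
      then have kA: "k \<subseteq> \<Union>A" unfolding A_def by auto
      then have "k \<in> M" using induced[of k] k AM(1) by blast
      then have "k \<inter> e = {}" if "e \<in> A" for e
        using disj[of k e] that k AM(1) \<open>k \<noteq> l\<close> by (auto simp: A_def)
      then have "k = {}" using kA by blast
      then show False using ne k by blast
    qed
    show "coef (mterm (sqfree (k - \<Union>B)) (esign idx k B) * \<theta> A (insert k B)) (sqfree l)
        = (if k = l then esign idx l B * coef (\<theta> A A) 0 else 0)"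
    proof (cases "k = l")
      case True
      then show ?thesis using coef_l[of l] by (simp add: dl A_def)
    next
      case False
      then show ?thesis using coef_l[of "k - \<Union>B"] not_l by auto
    qed
  qed
  also have "\<dots> = esign idx l B * coef (\<theta> A A) 0" using AM(4) ME "2.hyps" by auto
  finally have lhs: "coef (\<Sum>t\<in>Pow E. taylor_bd idx B t * \<theta> A t) (sqfree l) = esign idx l B * coef (\<theta> A A) 0" .
  have "coef (\<Sum>t\<in>Pow E. taylor_bd idx t A * \<theta> t B) (sqfree l) = (\<Sum>t\<in>Pow E. if t = B then esign idx l B * coef (\<theta> B B) 0 else 0)"
    unfolding lookup_sum
  proof (rule sum.cong[OF refl])
    fix t assume "t \<in> Pow E"
    show "coef (taylor_bd idx t A * \<theta> t B) (sqfree l) = (if t = B then esign idx l B * coef (\<theta> B B) 0 else 0)"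
    proof (cases "taylor_bd idx t A = (0 :: ('v, 'k) mpoly)")
      case True
      have "taylor_bd idx B A = (mterm (sqfree l) (esign idx l B) :: ('v, 'k) mpoly)"
        using taylor_bd_eq[of l A idx] "2.hyps" dl by (simp add: A_def)
      moreover have "esign idx l B \<noteq> (0 :: 'k)" by (simp add: esign_def)
      ultimately have "t \<noteq> B" using True by (metis lookup_single_eq lookup_zero)
      then show ?thesis using True by simp
    next
      case False
      then obtain k where k: "k \<in> A" "t = A - {k}" by (rule taylor_bd_nonzero)
      have "k \<inter> e = {}" if "e \<in> t" for e using disj[of k e] that k AM(1) by auto
      then have kt: "k - \<Union>t = k" by blast
      have tB: "t = B \<longleftrightarrow> k = l" using k "2.hyps" by (auto simp: A_def)
      have "\<not> k \<subset> l" using sub[of k] k AM(1) by auto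
      then have "coef (taylor_bd idx t A * \<theta> t B) (sqfree l) = (if k = l then esign idx k t * coef (\<theta> t B) 0 else 0)"
        using coef_l[of k] unfolding k(2) taylor_bd_eq[OF k(1)] using kt k(2) by simp
      then show ?thesis using tB by auto
    qed
  qed
  also have "\<dots> = esign idx l B * coef (\<theta> B B) 0" using AM(3) by simp
  also have "\<dots> = esign idx l B" using "2.IH" "2.prems" by simp
  finally have "esign idx l B * coef (\<theta> A A) 0 = (esign idx l B :: 'k)"
    using chain[OF AM(2,3)] lhs by simp
  then have "esign idx l B * (esign idx l B * coef (\<theta> A A) 0) = (esign idx l B * esign idx l B :: 'k)" by (rule arg_cong)
  then show ?case unfolding esign_square A_def .
qed

lemma induced_matching_basis_element:
  fixes E :: "'v::finite set set"
  assumes E: "simple_graph E" and M: "induced_matching E M"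
    and C: "based_resolution (edge_ideal E :: ('v, 'k::field) mpoly set) B hdeg ideg D a"
  obtains c where "c \<in> B" "hdeg c = card M" "ideg c = 2 * int (card M)"
proof -
  obtain idx :: "'v set \<Rightarrow> nat" where idx: "inj_on idx E"
    using finite_imp_inj_to_nat_seg[of E] by auto
  note T = taylor_resolution[OF E idx, where 'k = 'k]
  interpret T: based_resolution "edge_ideal E :: ('v, 'k) mpoly set" "Pow E" card "\<lambda>A. int (card (\<Union>A))"
    "taylor_bd idx" taylor_aug by (rule T)
  interpret C: based_resolution "edge_ideal E :: ('v, 'k) mpoly set" B hdeg ideg D a by (rule C)
  obtain \<phi> where \<phi>: "\<And>A. A \<in> Pow E \<Longrightarrow> C.bihomogeneous (card A) (int (card (\<Union>A))) (\<phi> A)"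
    "\<And>A s. A \<in> Pow E \<Longrightarrow> s \<in> B \<Longrightarrow> (\<Sum>t\<in>B. D s t * \<phi> A t) = (\<Sum>t\<in>Pow E. taylor_bd idx t A * \<phi> t s)"
    "\<And>A. A \<in> Pow E \<Longrightarrow> (\<Sum>t\<in>B. a t * \<phi> A t) - taylor_aug A \<in> edge_ideal E"
    using comparison_map[OF T C] by blast
  obtain \<psi> where "\<And>c. c \<in> B \<Longrightarrow> T.bihomogeneous (hdeg c) (ideg c) (\<psi> c)" and \<psi>:
    "\<And>c s. c \<in> B \<Longrightarrow> s \<in> Pow E \<Longrightarrow> (\<Sum>t\<in>Pow E. taylor_bd idx s t * \<psi> c t) = (\<Sum>t\<in>B. D t c * \<psi> t s)"
    "\<And>c. c \<in> B \<Longrightarrow> (\<Sum>t\<in>Pow E. taylor_aug t * \<psi> c t) - a c \<in> edge_ideal E"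
    using comparison_map[OF C T] by blast
  define \<theta> where "\<theta> A s = (\<Sum>c\<in>B. \<phi> A c * \<psi> c s)" for A s
  have "coef (\<theta> M M) 0 = 1"
  proof (rule taylor_endomorphism_diagonal[where \<theta> = \<theta> and A = M and idx = idx, OF E M])
    fix A s assume As: "A \<subseteq> E" "s \<subseteq> E"
    have "(\<Sum>t\<in>Pow E. taylor_bd idx s t * \<theta> A t) = (\<Sum>c\<in>B. \<phi> A c * (\<Sum>t\<in>Pow E. taylor_bd idx s t * \<psi> c t))"
      unfolding \<theta>_def sum_distrib_left by (subst sum.swap) (simp add: ac_simps)
    also have "\<dots> = (\<Sum>c\<in>B. \<phi> A c * (\<Sum>t\<in>B. D t c * \<psi> t s))"
      using \<psi>(1) As(2) by simp
    also have "\<dots> = (\<Sum>t\<in>B. (\<Sum>c\<in>B. D t c * \<phi> A c) * \<psi> t s)"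
      unfolding sum_distrib_left sum_distrib_right by (subst sum.swap) (simp add: ac_simps)
    also have "\<dots> = (\<Sum>t\<in>B. (\<Sum>r\<in>Pow E. taylor_bd idx r A * \<phi> r t) * \<psi> t s)"
      using \<phi>(2) As(1) by simp
    also have "\<dots> = (\<Sum>r\<in>Pow E. taylor_bd idx r A * \<theta> r s)"
      unfolding \<theta>_def sum_distrib_left sum_distrib_right by (subst sum.swap) (simp add: ac_simps)
    finally show "(\<Sum>t\<in>Pow E. taylor_bd idx s t * \<theta> A t) = (\<Sum>t\<in>Pow E. taylor_bd idx t A * \<theta> t s)" .
  next
    \<comment> \<open>This sum equals \<open>\<theta> {} {} - 1\<close>: the augmentation defect of
      \<open>\<psi>\<close> weighted with \<open>\<phi> {}\<close>, plus the defect of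
      \<open>\<phi>\<close> itself.\<close>
    have "(\<Sum>c\<in>B. \<phi> {} c * (\<psi> c {} - a c)) + ((\<Sum>c\<in>B. a c * \<phi> {} c) - 1) \<in> edge_ideal E"
      using \<psi>(2) \<phi>(3)[of "{}"] unfolding sum_taylor_aug
      by (intro T.ideal_add T.ideal_sum T.ideal_mult) (simp_all add: taylor_aug_def)
    then show "\<theta> {} {} - 1 \<in> edge_ideal E"
      by (simp add: \<theta>_def right_diff_distrib sum_subtractf ac_simps)
  qed simp
  \<comment> \<open>Constant terms are multiplicative, so some \<open>\<phi> M c\<close> has a
    nonzero one; bihomogeneity then gives \<open>c\<close> the bidegree of \<open>M\<close>.\<close>
  then have "(\<Sum>c\<in>B. coef (\<phi> M c) 0 * coef (\<psi> c M) 0) \<noteq> 0"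
    by (simp add: \<theta>_def lookup_sum coef_mult_0)
  then have "\<exists>c\<in>B. coef (\<phi> M c) 0 * coef (\<psi> c M) 0 \<noteq> 0" by (meson sum.neutral)
  then obtain c where c: "c \<in> B" "coef (\<phi> M c) 0 \<noteq> 0" by auto
  have ME: "M \<in> Pow E" using M unfolding induced_matching_def by simp
  have "hdeg c = card M" "homogeneous (int (card (\<Union>M)) - ideg c) (\<phi> M c)"
    using \<phi>(1)[OF ME] c unfolding C.bihomogeneous_def by (metis lookup_zero, metis)
  moreover have "ideg c = 2 * int (card M)"
    using homogeneous_unit(1)[OF calculation(2) c(2)] card_Union_matching[OF E M] by simp
  ultimately show thesis using that c(1) by blast
qed

subsection \<open>Passage between based resolutions and resolutions by matrices\<close>

lemma scalar_prod_sum: "dim_vec w = n \<Longrightarrow> v \<bullet> w = (\<Sum>i<n. v $ i * w $ i)"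
  unfolding scalar_prod_def lessThan_atLeast0 by simp

lemma mult_mat_vec_nth:
  assumes "A \<in> carrier_mat m n" "w \<in> carrier_vec n" "r < m"
  shows "(A *\<^sub>v w) $ r = (\<Sum>c<n. A $$ (r, c) * w $ c)"
  using assms by (auto simp: scalar_prod_def lessThan_atLeast0 intro!: sum.cong)

text \<open>Finite length makes the union of all bases finite. Families on it correspond to
  sequences of column vectors, so exactness in the single degrees combines into one
  statement.\<close>

lemma based_resolution_of_complex:
  fixes C :: "('v::finite, 'k::field) graded_complex"
  assumes I: "homogeneous_ideal I" and g: "graded_maps C" and e: "exact_complex I C"
    and l: "\<And>i. i > l \<Longrightarrow> shifts C i = []"
  shows "based_resolution I (SIGMA i:{..l}. {..<length (shifts C i)}) fst (\<lambda>(i, c). shifts C i ! c)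
    (\<lambda>(i, r) (j, c). if j = Suc i then bd C j $$ (r, c) else 0) (\<lambda>(i, c). if i = 0 then aug C $ c else 0)"
    (is "based_resolution I ?B fst ?g ?D ?a")
proof -
  interpret homogeneous_ideal I by (rule I)
  define n where "n i = length (shifts C i)" for i
  have n0: "n i = 0" if "i > l" for i using l[OF that] by (simp add: n_def)
  have auC: "aug C \<in> carrier_vec (n 0)" and bdC: "bd C (Suc i) \<in> carrier_mat (n i) (n (Suc i))" for i
    using g unfolding graded_maps_def n_def by auto
  have auh: "c < n 0 \<Longrightarrow> homogeneous (shifts C 0 ! c) (aug C $ c)" for c
    using g unfolding graded_maps_def n_def by auto
  have bdh: "r < n i \<Longrightarrow> c < n (Suc i) \<Longrightarrow> homogeneous (shifts C (Suc i) ! c - shifts C i ! r) (bd C (Suc i) $$ (r, c))" for i r c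
    using g unfolding graded_maps_def n_def by auto
  have e0: "\<exists>w\<in>carrier_vec (n 0). f - aug C \<bullet> w \<in> I" for f using e unfolding exact_complex_def n_def by blast
  have e1: "{w \<in> carrier_vec (n 0). aug C \<bullet> w \<in> I} = (\<lambda>w. bd C 1 *\<^sub>v w) ` carrier_vec (n 1)"
    using e unfolding exact_complex_def n_def by blast
  have e2: "{w \<in> carrier_vec (n (Suc i)). bd C (Suc i) *\<^sub>v w = 0\<^sub>v (n i)} = (\<lambda>w. bd C (Suc (Suc i)) *\<^sub>v w) ` carrier_vec (n (Suc (Suc i)))" for i
    using e unfolding exact_complex_def n_def by blast
  have B: "(i, c) \<in> ?B \<longleftrightarrow> c < n i" for i c using n0[of i] by (cases "i \<le> l") (auto simp: n_def)
  have sum_B: "(\<Sum>x\<in>?B. f x) = (\<Sum>i\<le>l. \<Sum>c<n i. f (i, c))" for f :: "nat \<times> nat \<Rightarrow> ('v, 'k) mpoly"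
    unfolding n_def by (subst sum.Sigma) (auto simp: case_prod_unfold)
  have row: "(\<Sum>t\<in>?B. ?D (i, r) t * v t) = (\<Sum>c<n (Suc i). bd C (Suc i) $$ (r, c) * v (Suc i, c))" for i r v
  proof -
    have "(\<Sum>t\<in>?B. ?D (i, r) t * v t) = (\<Sum>j\<le>l. if j = Suc i then (\<Sum>c<n (Suc i). bd C (Suc i) $$ (r, c) * v (Suc i, c)) else 0)"
      unfolding sum_B by (intro sum.cong) auto
    then show ?thesis using n0[of "Suc i"] by (cases "Suc i \<le> l") auto
  qed
  have aug: "(\<Sum>t\<in>?B. ?a t * v t) = (\<Sum>c<n 0. aug C $ c * v (0, c))" for v
  proof -
    have "(\<Sum>t\<in>?B. ?a t * v t) = (\<Sum>j\<le>l. if j = 0 then (\<Sum>c<n 0. aug C $ c * v (0, c)) else 0)"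
      unfolding sum_B by (intro sum.cong) auto
    then show ?thesis by simp
  qed
  define part where "part v i = vec (n i) (\<lambda>c. v (i, c))" for v :: "nat \<times> nat \<Rightarrow> ('v, 'k) mpoly" and i
  have part: "part v i \<in> carrier_vec (n i)" "c < n i \<Longrightarrow> part v i $ c = v (i, c)" for v i c
    by (simp_all add: part_def)
  define bdry where "bdry v s = (\<Sum>t\<in>?B. ?D s t * v t)" for v s
  have bd_row: "r < n i \<Longrightarrow> (bd C (Suc i) *\<^sub>v part v (Suc i)) $ r = bdry v (i, r)" for i r v
    unfolding bdry_def row by (subst mult_mat_vec_nth[OF bdC part(1)]) (simp_all add: part(2))
  have bd_part: "bd C (Suc i) *\<^sub>v part v (Suc i) = part (bdry v) i" for v i
  proof (rule eq_vecI)
    fix r assume "r < dim_vec (part (bdry v) i)"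
    then have "r < n i" by (simp add: part_def)
    then show "(bd C (Suc i) *\<^sub>v part v (Suc i)) $ r = part (bdry v) i $ r" by (simp only: bd_row part(2))
  qed (use bdC[of i] in \<open>simp add: part_def\<close>)
  have aug_part: "aug C \<bullet> part v 0 = (\<Sum>t\<in>?B. ?a t * v t)" for v
    unfolding aug by (subst scalar_prod_sum[of _ "n 0"]) (simp_all add: part_def)
  have zero_part: "part v i = 0\<^sub>v (n i) \<longleftrightarrow> (\<forall>c<n i. v (i, c) = 0)" for v i
    by (auto simp: part_def vec_eq_iff)
  show ?thesis
  proof unfold_locales
    show "finite ?B" by auto
  next
    fix s t assume st: "s \<in> ?B" "t \<in> ?B"
    obtain i r j c where ij: "s = (i, r)" "t = (j, c)" by fastforce
    show "fst t = Suc (fst s)" if "?D s t \<noteq> 0" using that unfolding ij by (auto split: if_splits)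
    show "homogeneous (?g t - ?g s) (?D s t)" using st bdh unfolding ij B by auto
  next
    fix t assume t: "t \<in> ?B"
    obtain j c where j: "t = (j, c)" by fastforce
    show "fst t = 0" if "?a t \<noteq> 0" using that unfolding j by (auto split: if_splits)
    show "homogeneous (?g t) (?a t)" using t auh unfolding j B by auto
  next
    fix v
    have "bd C 1 *\<^sub>v part v 1 \<in> {w \<in> carrier_vec (n 0). aug C \<bullet> w \<in> I}"
      unfolding e1 using part(1) by blast
    then have "aug C \<bullet> part (bdry v) 0 \<in> I" unfolding One_nat_def bd_part by simp
    then show "(\<Sum>s\<in>?B. ?a s * (\<Sum>t\<in>?B. ?D s t * v t)) \<in> I" unfolding aug_part bdry_def .
  next
    fix s v assume s: "s \<in> ?B"
    obtain i r where i: "s = (i, r)" by fastforce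
    have "part (bdry v) (Suc i) \<in> {w \<in> carrier_vec (n (Suc i)). bd C (Suc i) *\<^sub>v w = 0\<^sub>v (n i)}"
      unfolding bd_part[symmetric] e2 using part(1) by blast
    then have "part (bdry (bdry v)) i = 0\<^sub>v (n i)" using bd_part[of i "bdry v"] by simp
    then have "bdry (bdry v) s = 0" using s unfolding zero_part i B by blast
    then show "(\<Sum>r\<in>?B. ?D s r * (\<Sum>t\<in>?B. ?D r t * v t)) = 0" unfolding bdry_def .
  next
    fix v assume cyc: "\<And>s. s \<in> ?B \<Longrightarrow> (\<Sum>t\<in>?B. ?D s t * v t) = 0" and av: "(\<Sum>t\<in>?B. ?a t * v t) \<in> I"
    have "\<exists>u. u \<in> carrier_vec (n (Suc i)) \<and> part v i = bd C (Suc i) *\<^sub>v u" for i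
    proof (cases i)
      case 0
      have "part v 0 \<in> {w \<in> carrier_vec (n 0). aug C \<bullet> w \<in> I}" using part(1) av aug_part by simp
      then show ?thesis unfolding e1 0 by auto
    next
      case (Suc j)
      have "bd C (Suc j) *\<^sub>v part v (Suc j) = 0\<^sub>v (n j)"
        unfolding bd_part zero_part bdry_def using cyc B by blast
      then have "part v (Suc j) \<in> {w \<in> carrier_vec (n (Suc j)). bd C (Suc j) *\<^sub>v w = 0\<^sub>v (n j)}" using part(1) by simp
      then show ?thesis unfolding e2 Suc by auto
    qed
    then obtain u where u: "\<And>i. u i \<in> carrier_vec (n (Suc i))" "\<And>i. part v i = bd C (Suc i) *\<^sub>v u i" by metis
    \<comment> \<open>The preimage chosen for block \<open>j\<close> is stored in block
      \<open>j + 1\<close>; what block 0 receives is never read by a boundary.\<close>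
    define w where "w = (\<lambda>(j, c). u (j - 1) $ c)"
    have "part w (Suc i) = u i" for i using u(1)[of i] by (intro eq_vecI) (auto simp: part_def w_def)
    then have eq: "part v i = part (bdry w) i" for i using u(2)[of i] bd_part[of i w] by simp
    have "v s = bdry w s" if s: "s \<in> ?B" for s
    proof -
      obtain i r where ir: "s = (i, r)" by fastforce
      then have "r < n i" using s B by blast
      then show ?thesis unfolding ir using part(2) eq by metis
    qed
    then show "\<exists>u. \<forall>s\<in>?B. v s = (\<Sum>t\<in>?B. ?D s t * u t)" unfolding bdry_def by blast
  next
    obtain w where w: "w \<in> carrier_vec (n 0)" "1 - aug C \<bullet> w \<in> I" using e0 by blast
    define v :: "nat \<times> nat \<Rightarrow> ('v, 'k) mpoly" where "v = (\<lambda>(i, c). w $ c)"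
    have "part v 0 = w" using w(1) by (intro eq_vecI) (auto simp: part_def v_def)
    then have "(\<Sum>t\<in>?B. ?a t * v t) = aug C \<bullet> w" using aug_part[of v] by simp
    then have "(\<Sum>t\<in>?B. ?a t * v t) - 1 = - 1 * (1 - aug C \<bullet> w)" by simp
    then have "(\<Sum>t\<in>?B. ?a t * v t) - 1 \<in> I" using ideal_mult[OF w(2), of "- 1"] by simp
    then show "\<exists>v. (\<Sum>t\<in>?B. ?a t * v t) - 1 \<in> I" by blast
  qed
qed

lemma irrelevant_idealI:
  fixes f :: "('v::finite, 'k::field) mpoly"
  assumes "coef f 0 = 0"
  shows "f \<in> irrelevant_ideal"
proof -
  have "mterm m x \<in> (irrelevant_ideal :: ('v, 'k) mpoly set)" if ne: "m \<noteq> 0" for m x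
  proof -
    obtain v where v: "coef m v \<noteq> 0" using ne by (metis lookup_zero poly_mapping_eqI)
    have "m = (m - Poly_Mapping.single v 1) + Poly_Mapping.single v 1"
      using v by (intro poly_mapping_eqI) (auto simp: lookup_add lookup_minus lookup_single when_def)
    then have "mterm m x = mterm (m - Poly_Mapping.single v 1) x * Var v"
      unfolding Var_def by (metis mult_single mult.right_neutral)
    then show ?thesis unfolding irrelevant_ideal_def ideal_generated_def
      by (metis Modules.module.span_scale[OF module_times] Modules.module.span_base[OF module_times] rangeI)
  qed
  then have "(\<Sum>m\<in>Poly_Mapping.keys f. mterm m (coef f m)) \<in> irrelevant_ideal"
    using assms unfolding irrelevant_ideal_def ideal_generated_def
    by (intro Modules.module.span_sum[OF module_times]) (metis in_keys_iff)
  then show ?thesis using poly_expand[of f] by simp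
qed

text \<open>Listing the basis elements of each homological degree turns \<open>D\<close> into a
  sequence of matrices. A vector of a single degree is extended by zero, so exactness of the total
  complex yields exactness in that degree.\<close>

lemma complex_of_based_resolution:
  fixes I :: "('v::finite, 'k::field) mpoly set"
  assumes R: "based_resolution I B hdeg ideg D a"
    and minimal: "\<And>s t. s \<in> B \<Longrightarrow> t \<in> B \<Longrightarrow> coef (D s t) 0 = 0"
  shows "\<exists>C. minimal_graded_free_resolution I C"
proof -
  interpret based_resolution I B hdeg ideg D a by (rule R)
  have "\<forall>i. \<exists>xs. set xs = {b \<in> B. hdeg b = i} \<and> distinct xs"
    using finite_B by (auto intro: finite_distinct_list)
  then obtain L where L: "\<And>i. set (L i) = {b \<in> B. hdeg b = i}" "\<And>i. distinct (L i)" by metis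
  define n where "n i = length (L i)" for i
  have nth_B: "L i ! c \<in> B" "hdeg (L i ! c) = i" if "c < n i" for i c
    using nth_mem[of c "L i"] that unfolding n_def L(1) by auto
  have sum_L: "(\<Sum>t\<in>B. f t) = (\<Sum>c<n i. f (L i ! c))" if "\<And>t. t \<in> B \<Longrightarrow> hdeg t \<noteq> i \<Longrightarrow> f t = 0"
    for f :: "'a \<Rightarrow> ('v, 'k) mpoly" and i
  proof -
    have "(\<Sum>t\<in>B. f t) = (\<Sum>t\<in>set (L i). f t)"
      using that by (intro sum.mono_neutral_right finite_B) (auto simp: L(1))
    also have "\<dots> = (\<Sum>c<n i. f (L i ! c))"
      unfolding n_def by (rule sum.reindex_bij_betw[symmetric]) (rule bij_betw_nth[OF L(2) refl refl])
    finally show ?thesis .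
  qed
  define part where "part v i = vec (n i) (\<lambda>c. v (L i ! c))" for v :: "'a \<Rightarrow> ('v, 'k) mpoly" and i
  have part: "part v i \<in> carrier_vec (n i)" "c < n i \<Longrightarrow> part v i $ c = v (L i ! c)" for v i c
    by (simp_all add: part_def)
  have part_zero: "part v i = 0\<^sub>v (n i) \<longleftrightarrow> (\<forall>s\<in>B. hdeg s = i \<longrightarrow> v s = 0)" for v i
  proof
    assume z: "part v i = 0\<^sub>v (n i)"
    show "\<forall>s\<in>B. hdeg s = i \<longrightarrow> v s = 0"
    proof (intro ballI impI)
      fix s assume "s \<in> B" "hdeg s = i"
      then have "s \<in> set (L i)" by (simp add: L(1))
      then obtain c where "c < n i" "s = L i ! c" unfolding n_def by (auto simp: in_set_conv_nth)
      then show "v s = 0" using part(2)[of c i v] z by simp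
    qed
  qed (auto simp: part_def nth_B intro!: eq_vecI)
  have part_cong: "part v i = part u i" if "\<And>s. s \<in> B \<Longrightarrow> v s = u s" for v u i
    unfolding part_def by (intro eq_vecI) (simp_all add: that nth_B)
  have part_surj: "\<exists>v. part v i = w \<and> (\<forall>t. hdeg t \<noteq> i \<longrightarrow> v t = 0)" if w: "w \<in> carrier_vec (n i)" for w i
  proof -
    define v where "v t = (if hdeg t = i then w $ (THE c. c < n i \<and> L i ! c = t) else 0)" for t
    have "(THE c'. c' < n i \<and> L i ! c' = L i ! c) = c" if "c < n i" for c
      using that L(2)[of i] unfolding n_def by (intro the_equality) (auto simp: nth_eq_iff_index_eq)
    then have "part v i = w"
      using w by (intro eq_vecI) (auto simp: part_def v_def nth_B)
    then show ?thesis by (intro exI[of _ v]) (simp add: v_def)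
  qed
  define C where "C = \<lparr>shifts = \<lambda>i. map ideg (L i),
    bd = \<lambda>i. mat (n (i - 1)) (n i) (\<lambda>(r, c). D (L (i - 1) ! r) (L i ! c)),
    aug = vec (n 0) (\<lambda>c. a (L 0 ! c))\<rparr>"
  have shC: "shifts C i = map ideg (L i)" and lenC: "length (shifts C i) = n i" for i by (simp_all add: C_def n_def)
  have shC_nth: "c < n i \<Longrightarrow> shifts C i ! c = ideg (L i ! c)" for i c by (simp add: C_def n_def)
  have bdC: "bd C (Suc i) \<in> carrier_mat (n i) (n (Suc i))"
    "r < n i \<Longrightarrow> c < n (Suc i) \<Longrightarrow> bd C (Suc i) $$ (r, c) = D (L i ! r) (L (Suc i) ! c)" for i r c
    by (simp_all add: C_def)
  have auC: "aug C \<in> carrier_vec (n 0)" "c < n 0 \<Longrightarrow> aug C $ c = a (L 0 ! c)" for c by (simp_all add: C_def)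
  define bdry where "bdry v s = (\<Sum>t\<in>B. D s t * v t)" for v s
  define au where "au v = (\<Sum>t\<in>B. a t * v t)" for v
  have bd_part: "bd C (Suc i) *\<^sub>v part v (Suc i) = part (bdry v) i" for v i
  proof (rule eq_vecI)
    fix r assume "r < dim_vec (part (bdry v) i)"
    then have r: "r < n i" by (simp add: part_def)
    have "D (L i ! r) t * v t = 0" if "t \<in> B" "hdeg t \<noteq> Suc i" for t
      using D_hdeg[OF nth_B(1)[OF r] that(1)] nth_B(2)[OF r] that(2) by (cases "D (L i ! r) t = 0") auto
    then have "bdry v (L i ! r) = (\<Sum>c<n (Suc i). D (L i ! r) (L (Suc i) ! c) * v (L (Suc i) ! c))"
      unfolding bdry_def by (rule sum_L)
    then show "(bd C (Suc i) *\<^sub>v part v (Suc i)) $ r = part (bdry v) i $ r"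
      by (subst mult_mat_vec_nth[OF bdC(1) part(1) r]) (simp add: r bdC(2) part(2))
  qed (use bdC(1)[of i] in \<open>simp add: part_def\<close>)
  have aug_part: "aug C \<bullet> part v 0 = au v" for v
  proof -
    have "a t * v t = 0" if "t \<in> B" "hdeg t \<noteq> 0" for t using a_hdeg[OF that(1)] that(2) by (cases "a t = 0") auto
    then have "au v = (\<Sum>c<n 0. a (L 0 ! c) * v (L 0 ! c))"
      unfolding au_def by (rule sum_L)
    then show ?thesis by (subst scalar_prod_sum[of _ "n 0"]) (simp_all add: auC part_def)
  qed
  have exactD: "\<exists>u. part v i = bd C (Suc i) *\<^sub>v part u (Suc i)"
    if supp: "\<forall>t. hdeg t \<noteq> i \<longrightarrow> v t = 0" and cyc: "\<And>j. i = Suc j \<Longrightarrow> part (bdry v) j = 0\<^sub>v (n j)" and av: "au v \<in> I" for v i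
  proof -
    have "bdry v s = 0" if s: "s \<in> B" for s
    proof (cases "i = Suc (hdeg s)")
      case True
      then show ?thesis using cyc s part_zero by blast
    next
      case False
      have "D s t * v t = 0" if "t \<in> B" for t using D_hdeg[OF s that] supp False by (cases "D s t = 0") auto
      then show ?thesis unfolding bdry_def by simp
    qed
    then obtain u where "\<And>s. s \<in> B \<Longrightarrow> v s = bdry u s"
      using exact[of v] av unfolding bdry_def au_def by blast
    then have "part v i = part (bdry u) i" by (rule part_cong)
    then show ?thesis unfolding bd_part by blast
  qed
  have "graded_maps C"
    unfolding graded_maps_def lenC
    using auC bdC a_homogeneous D_homogeneous by (auto simp: nth_B shC_nth)
  moreover have "exact_complex I C"
    unfolding exact_complex_def lenC
  proof (intro conjI allI)
    fix f
    obtain v where v: "au v - 1 \<in> I" using onto unfolding au_def by blast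
    have "au (\<lambda>t. f * v t) = f * au v" unfolding au_def by (simp add: sum_distrib_left ac_simps)
    then have "f - aug C \<bullet> part (\<lambda>t. f * v t) 0 = (- f) * (au v - 1)" unfolding aug_part by (simp add: algebra_simps)
    then show "\<exists>w\<in>carrier_vec (n 0). f - aug C \<bullet> w \<in> I" using ideal_mult[OF v] part(1) by metis
  next
    show "{w \<in> carrier_vec (n 0). aug C \<bullet> w \<in> I} = (\<lambda>w. bd C 1 *\<^sub>v w) ` carrier_vec (n 1)"
    proof (intro equalityI subsetI)
      fix w assume "w \<in> {w \<in> carrier_vec (n 0). aug C \<bullet> w \<in> I}"
      then have w: "w \<in> carrier_vec (n 0)" "aug C \<bullet> w \<in> I" by auto
      obtain v where v: "part v 0 = w" "\<forall>t. hdeg t \<noteq> 0 \<longrightarrow> v t = 0" using part_surj[OF w(1)] by blast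
      then have "\<exists>u. part v 0 = bd C (Suc 0) *\<^sub>v part u (Suc 0)"
        using w(2) aug_part by (intro exactD) auto
      then show "w \<in> (\<lambda>w. bd C 1 *\<^sub>v w) ` carrier_vec (n 1)" using part(1) v(1) by auto
    next
      fix w assume "w \<in> (\<lambda>w. bd C 1 *\<^sub>v w) ` carrier_vec (n 1)"
      then obtain v where "w = bd C (Suc 0) *\<^sub>v part v (Suc 0)" using part_surj[of _ "Suc 0"] by fastforce
      then have w: "w = part (bdry v) 0" unfolding bd_part .
      have "au (bdry v) \<in> I" using aD[of v] unfolding au_def bdry_def .
      then show "w \<in> {w \<in> carrier_vec (n 0). aug C \<bullet> w \<in> I}" unfolding w using part(1) aug_part by simp
    qed
  next
    fix i
    show "{w \<in> carrier_vec (n (Suc i)). bd C (Suc i) *\<^sub>v w = 0\<^sub>v (n i)} = (\<lambda>w. bd C (Suc (Suc i)) *\<^sub>v w) ` carrier_vec (n (Suc (Suc i)))"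
    proof (intro equalityI subsetI)
      fix w assume "w \<in> {w \<in> carrier_vec (n (Suc i)). bd C (Suc i) *\<^sub>v w = 0\<^sub>v (n i)}"
      then have w: "w \<in> carrier_vec (n (Suc i))" "bd C (Suc i) *\<^sub>v w = 0\<^sub>v (n i)" by auto
      obtain v where v: "part v (Suc i) = w" "\<forall>t. hdeg t \<noteq> Suc i \<longrightarrow> v t = 0" using part_surj[OF w(1)] by blast
      have "a t * v t = 0" if "t \<in> B" for t using a_hdeg[OF that] v(2) by (cases "a t = 0") auto
      then have "au v \<in> I" unfolding au_def using ideal_0 by simp
      moreover have "part (bdry v) i = 0\<^sub>v (n i)" using w(2) bd_part[of i v] v(1) by simp
      ultimately have "\<exists>u. part v (Suc i) = bd C (Suc (Suc i)) *\<^sub>v part u (Suc (Suc i))"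
        using v(2) by (intro exactD) auto
      then show "w \<in> (\<lambda>w. bd C (Suc (Suc i)) *\<^sub>v w) ` carrier_vec (n (Suc (Suc i)))" using part(1) v(1) by auto
    next
      fix w assume "w \<in> (\<lambda>w. bd C (Suc (Suc i)) *\<^sub>v w) ` carrier_vec (n (Suc (Suc i)))"
      then obtain v where "w = bd C (Suc (Suc i)) *\<^sub>v part v (Suc (Suc i))" using part_surj[of _ "Suc (Suc i)"] by fastforce
      then have w: "w = part (bdry v) (Suc i)" unfolding bd_part .
      have "bdry (bdry v) s = 0" if "s \<in> B" for s using DD[OF that, of v] unfolding bdry_def .
      then have "part (bdry (bdry v)) i = 0\<^sub>v (n i)" unfolding part_zero by blast
      then show "w \<in> {w \<in> carrier_vec (n (Suc i)). bd C (Suc i) *\<^sub>v w = 0\<^sub>v (n i)}"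
        unfolding w using part(1) bd_part by simp
    qed
  qed
  moreover have "minimal_complex C"
    unfolding minimal_complex_def lenC by (simp add: bdC nth_B minimal irrelevant_idealI)
  moreover have "\<exists>l. \<forall>i>l. shifts C i = []"
  proof (intro exI allI impI)
    fix i assume "Max (hdeg ` B) < i"
    then have "set (L i) = {}" unfolding L(1) using finite_B
      by (auto simp: not_less[symmetric]) (metis Max_ge finite_imageI image_eqI not_less)
    then show "shifts C i = []" by (simp add: shC)
  qed
  ultimately show ?thesis unfolding minimal_graded_free_resolution_def by blast
qed

lemma edge_ideal_minimal_resolution:
  fixes E :: "'v::finite set set"
  assumes "simple_graph E"
  shows "\<exists>C. minimal_graded_free_resolution (edge_ideal E :: ('v, 'k::field) mpoly set) C"
proof -
  obtain idx :: "'v set \<Rightarrow> nat" where "inj_on idx E"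
    using finite_imp_inj_to_nat_seg[of E] by auto
  from taylor_resolution[OF assms this, where 'k = 'k] obtain B' D' where
    "based_resolution (edge_ideal E :: ('v, 'k) mpoly set) B' card (\<lambda>A. int (card (\<Union>A))) D' taylor_aug"
    "\<And>s t. s \<in> B' \<Longrightarrow> t \<in> B' \<Longrightarrow> coef (D' s t) 0 = 0"
    using minimal_based_resolution by blast
  then show ?thesis by (rule complex_of_based_resolution)
qed

lemma reg_quotient_ge_induced_matching:
  fixes E :: "'v::finite set set"
  assumes E: "simple_graph E" and M: "induced_matching E M"
  shows "reg_quotient (edge_ideal E :: ('v, 'k::field) mpoly set) \<ge> int (card M)"
proof -
  define I :: "('v, 'k) mpoly set" where "I = edge_ideal E"
  define C where "C = (SOME C. minimal_graded_free_resolution I C)"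
  have C: "minimal_graded_free_resolution I C"
    unfolding C_def I_def by (rule someI_ex[OF edge_ideal_minimal_resolution[OF E]])
  have betti: "graded_betti I i j \<noteq> 0 \<longleftrightarrow> j \<in> set (shifts C i)" for i j
    by (simp add: graded_betti_def C_def count_list_0_iff)
  obtain l where l: "\<And>i. i > l \<Longrightarrow> shifts C i = []"
    using C unfolding minimal_graded_free_resolution_def by blast
  have "based_resolution (edge_ideal E :: ('v, 'k) mpoly set) (SIGMA i:{..l}. {..<length (shifts C i)}) fst (\<lambda>(i, c). shifts C i ! c)
    (\<lambda>(i, r) (j, c). if j = Suc i then bd C j $$ (r, c) else 0) (\<lambda>(i, c). if i = 0 then aug C $ c else 0)"
    by (rule based_resolution_of_complex[OF homogeneous_edge_ideal[OF E] _ _ l])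
      (use C in \<open>simp_all add: minimal_graded_free_resolution_def I_def\<close>)
  then obtain x where x: "x \<in> (SIGMA i:{..l}. {..<length (shifts C i)})"
    "fst x = card M" "(\<lambda>(i, c). shifts C i ! c) x = 2 * int (card M)"
    by (rule induced_matching_basis_element[OF E M])
  then have "graded_betti I (card M) (2 * int (card M)) \<noteq> 0"
    unfolding betti by (auto simp: in_set_conv_nth)
  then have "int (card M) \<in> {j - int i | i j. graded_betti I i j \<noteq> 0}" by force
  \<comment> \<open>\<open>Max\<close> is meaningful only on finite sets; finiteness comes from the
    finite length and the finite lists of shifts.\<close>
  moreover have "finite {j - int i | i j. graded_betti I i j \<noteq> 0}"
  proof (rule finite_subset)
    have "i \<le> l" if "j \<in> set (shifts C i)" for i j using l[of i] that by (cases "i \<le> l") auto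
    then show "{j - int i | i j. graded_betti I i j \<noteq> 0} \<subseteq> (\<lambda>(i, j). j - int i) ` (SIGMA i:{..l}. set (shifts C i))"
      unfolding betti by force
  qed auto
  ultimately show ?thesis unfolding reg_quotient_def I_def[symmetric] by (intro Max_ge)
qed

theorem theorem3p1:
  fixes E :: "'v::finite set set" and n p d :: nat
  assumes "is_tree E"
    and "n = CARD('v)" and "n \<ge> 2"
    and "d = diameter E"
    and "p = card (pendant_vertices E)"
  shows "reg_quotient (edge_ideal E :: ('v, 'k::field) mpoly set)
           \<ge> \<lfloor>(real n - real p + real d + 5) / 6\<rfloor>"
proof -
  obtain M where M: "induced_matching E M" "n + d \<le> 6 * card M + p"
    using tree_induced_matching[of E] assms by auto
  \<comment> \<open>The inequality for \<open>M\<close> is additive because subtraction of naturals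
    truncates; over the reals \<open>p\<close> moves to the other side.\<close>
  have "\<lfloor>(real n - real p + real d + 5) / 6\<rfloor> \<le> int (card M)"
    using M(2) unfolding floor_le_iff by (simp add: field_simps)
  also have "\<dots> \<le> reg_quotient (edge_ideal E :: ('v, 'k) mpoly set)"
    using assms(1) M(1) by (intro reg_quotient_ge_induced_matching) (simp_all add: is_tree_def)
  finally show ?thesis .
qed

end
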